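(* The algebra $\mathcal{S}_\eta(\mathcal{O}_N)$, where $\eta(n)=N^n$, is fractal.
   Context: Let $N\ge 2$ be an integer and $\mathbb{Z}^+=\{0,1,2,\dots\}$. For $n\ge 1$, $P_n$ is the orthogonal projection of $l^2(\mathbb{Z}^+)$ onto the span of the first $n$ standard basis vectors. For $i\in\{0,\dots,N-1\}$, $S_i\in L(l^2(\mathbb{Z}^+))$ is the isometry $(S_i x)_{rN+i}=x_r$ for $r\ge 0$, with all other components of $S_ix$ equal to $0$. The concrete Cuntz algebra $\mathcal{O}_N$ is the smallest $C^*$-subalgebra of $L(l^2(\mathbb{Z}^+))$ containing $S_0,\dots,S_{N-1}$. Let $\mathcal{F}_\eta$ (with $\eta(n)=N^n$) be the $C^*$-algebra of all bounded sequences $(A_n)_{n\ge 0}$ with $A_n\in\mathbb{C}^{N^n\times N^n}$ (identified with operators on $\mathrm{im}\,P_{N^n}$), with entrywise operations and supremum norm, and $\mathcal{G}_\eta$ its closed ideal of sequences with $\|A_n\|\to 0$. $\mathcal{S}_\eta(\mathcal{O}_N)$ is the smallest $C^*$-subalgebra of $\mathcal{F}_\eta$ containing all sequences $(P_{N^n}AP_{N^n})_{n\ge0}$ with $A\in\mathcal{O}_N$. Fractality: for a strictly increasing sequence $\mu$ of non-negative integers let $R_\mu$ be the restriction mapping $(A_n)_{n\ge0}\mapsto (A_{\mu(n)})_{n}$ on $\mathcal{F}_\eta$. A $^*$-homomorphism $W$ from a $C^*$-subalgebra $\mathcal{S}$ of $\mathcal{F}_\eta$ into a $C^*$-algebra $\mathcal{B}$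 is called fractal if for every strictly increasing sequence $\mu$ there is a mapping $W_\mu:R_\mu(\mathcal{S})\to\mathcal{B}$ such that $W=W_\mu\circ R_\mu|_{\mathcal{S}}$. A $C^*$-subalgebra $\mathcal{S}$ of $\mathcal{F}_\eta$ is called fractal if the canonical homomorphism $\mathcal{S}\to\mathcal{S}/(\mathcal{S}\cap\mathcal{G}_\eta)$ is fractal. *)

theory Defs
  imports "HOL-Analysis.Analysis"
begin

section \<open>The Hilbert space of square-summable complex sequences\<close>

typedef ell2 = "{x :: nat \<Rightarrow> complex. summable (\<lambda>n. (norm (x n))\<^sup>2)}"
  morphisms ell2_nth Abs_ell2
  by (rule exI[of _ "\<lambda>_. 0"]) simp

setup_lifting type_definition_ell2

lemma ell2_eqI: "(\<And>n. ell2_nth x n = ell2_nth y n) \<Longrightarrow> x = y"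
  by (simp add: ell2_nth_inject[symmetric] fun_eq_iff)

lemma summable_ell2: "summable (\<lambda>n. (norm (ell2_nth x n))\<^sup>2)"
  using ell2_nth[of x] by simp

lemma norm_add_sq_le: "(norm (a + b))\<^sup>2 \<le> 2 * (norm a)\<^sup>2 + 2 * (norm (b :: complex))\<^sup>2"
proof -
  have "(norm (a + b))\<^sup>2 \<le> (norm a + norm b)\<^sup>2"
    by (intro power_mono norm_triangle_ineq) auto
  also have "\<dots> \<le> 2 * (norm a)\<^sup>2 + 2 * (norm b)\<^sup>2"
    using zero_le_power2[of "norm a - norm b"] by (simp add: power2_eq_square algebra_simps)
  finally show ?thesis .
qed

lemma summable_sq_add:
  fixes x y :: "nat \<Rightarrow> complex"
  assumes "summable (\<lambda>n. (norm (x n))\<^sup>2)" "summable (\<lambda>n. (norm (y n))\<^sup>2)"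
  shows "summable (\<lambda>n. (norm (x n + y n))\<^sup>2)"
proof (rule summable_comparison_test')
  show "summable (\<lambda>n. 2 * (norm (x n))\<^sup>2 + 2 * (norm (y n))\<^sup>2)"
    by (intro summable_add summable_mult assms)
  show "norm ((norm (x n + y n))\<^sup>2) \<le> 2 * (norm (x n))\<^sup>2 + 2 * (norm (y n))\<^sup>2" for n
    using norm_add_sq_le by simp
qed

lemma summable_sq_scale:
  fixes x :: "nat \<Rightarrow> complex"
  assumes "summable (\<lambda>n. (norm (x n))\<^sup>2)"
  shows "summable (\<lambda>n. (norm (c * x n))\<^sup>2)"
  using summable_mult[OF assms, of "(norm c)\<^sup>2"] by (simp add: norm_mult power_mult_distrib)

lemma summable_norm_prod:
  fixes x y :: "nat \<Rightarrow> complex"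
  assumes "summable (\<lambda>n. (norm (x n))\<^sup>2)" "summable (\<lambda>n. (norm (y n))\<^sup>2)"
  shows "summable (\<lambda>n. norm (x n) * norm (y n))"
proof (rule summable_comparison_test')
  show "summable (\<lambda>n. (norm (x n))\<^sup>2 + (norm (y n))\<^sup>2)"
    by (intro summable_add assms)
  fix n
  have "2 * (norm (x n) * norm (y n)) \<le> (norm (x n))\<^sup>2 + (norm (y n))\<^sup>2"
    using zero_le_power2[of "norm (x n) - norm (y n)"] by (simp add: power2_eq_square algebra_simps)
  moreover have "0 \<le> norm (x n) * norm (y n)" by simp
  ultimately show "norm (norm (x n) * norm (y n)) \<le> (norm (x n))\<^sup>2 + (norm (y n))\<^sup>2"
    unfolding real_norm_def by linarith
qed

lift_definition scaleC_ell2 :: "complex \<Rightarrow> ell2 \<Rightarrow> ell2" is "\<lambda>c x n. c * x n"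
  by (rule summable_sq_scale)

lift_definition cinner_ell2 :: "ell2 \<Rightarrow> ell2 \<Rightarrow> complex" is
  "\<lambda>x y. \<Sum>n. x n * cnj (y n)" .

instantiation ell2 :: real_vector
begin

lift_definition zero_ell2 :: ell2 is "\<lambda>_. 0" by simp
lift_definition plus_ell2 :: "ell2 \<Rightarrow> ell2 \<Rightarrow> ell2" is "\<lambda>x y n. x n + y n"
  by (rule summable_sq_add)
lift_definition uminus_ell2 :: "ell2 \<Rightarrow> ell2" is "\<lambda>x n. - x n" by simp
lift_definition minus_ell2 :: "ell2 \<Rightarrow> ell2 \<Rightarrow> ell2" is "\<lambda>x y n. x n - y n"
  subgoal for x y using summable_sq_add[of x "\<lambda>n. - y n"] by simp
  done
lift_definition scaleR_ell2 :: "real \<Rightarrow> ell2 \<Rightarrow> ell2" is "\<lambda>r x n. of_real r * x n"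
  by (rule summable_sq_scale)

instance
proof
  fix x y z :: ell2 and r s :: real
  show "x + y + z = x + (y + z)" by transfer (simp add: add.assoc)
  show "x + y = y + x" by transfer (simp add: add.commute)
  show "0 + x = x" by transfer simp
  show "- x + x = 0" by transfer simp
  show "x - y = x + - y" by transfer simp
  show "r *\<^sub>R (x + y) = r *\<^sub>R x + r *\<^sub>R y" by transfer (simp add: algebra_simps)
  show "(r + s) *\<^sub>R x = r *\<^sub>R x + s *\<^sub>R x" by transfer (simp add: algebra_simps)
  show "r *\<^sub>R s *\<^sub>R x = (r * s) *\<^sub>R x" by transfer (simp add: algebra_simps)
  show "1 *\<^sub>R x = x" by transfer simp
qed

end

text \<open>
  The type-class inner product is the real part of \<open>cinner_ell2\<close>; it induces the same norm,
  so that the library's metric, topological and operator-norm notions apply.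
\<close>

instantiation ell2 :: real_inner
begin

lift_definition inner_ell2 :: "ell2 \<Rightarrow> ell2 \<Rightarrow> real" is "\<lambda>x y. Re (\<Sum>n. x n * cnj (y n))" .
lift_definition norm_ell2 :: "ell2 \<Rightarrow> real" is "\<lambda>x. sqrt (\<Sum>n. (norm (x n))\<^sup>2)" .
definition "sgn_ell2 (x :: ell2) = x /\<^sub>R norm x"
definition "dist_ell2 (x :: ell2) y = norm (x - y)"
definition "(uniformity :: (ell2 \<times> ell2) filter) = (INF e\<in>{0 <..}. principal {(x, y). dist x y < e})"
definition "open_ell2 (U :: ell2 set) \<longleftrightarrow>
  (\<forall>x\<in>U. eventually (\<lambda>(x', y). x' = x \<longrightarrow> y \<in> U) uniformity)"

lemma summable_cinner_aux:
  fixes x y :: "nat \<Rightarrow> complex"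
  assumes "summable (\<lambda>n. (norm (x n))\<^sup>2)" "summable (\<lambda>n. (norm (y n))\<^sup>2)"
  shows "summable (\<lambda>n. x n * cnj (y n))"
  by (rule summable_norm_cancel) (use summable_norm_prod[OF assms] in \<open>simp add: norm_mult\<close>)

lemma inner_self_aux:
  fixes x :: "nat \<Rightarrow> complex"
  assumes "summable (\<lambda>n. (norm (x n))\<^sup>2)"
  shows "(\<Sum>n. x n * cnj (x n)) = of_real (\<Sum>n. (norm (x n))\<^sup>2)"
proof -
  have "complex_of_real (\<Sum>n. (norm (x n))\<^sup>2) = (\<Sum>n. complex_of_real ((norm (x n))\<^sup>2))"
    by (rule suminf_of_real[OF assms])
  then show ?thesis by (simp only: complex_norm_square)
qed

instance
proof
  fix x y z :: ell2 and r :: real and U :: "ell2 set"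
  show "sgn x = x /\<^sub>R norm x" by (rule sgn_ell2_def)
  show "dist x y = norm (x - y)" by (rule dist_ell2_def)
  show "(uniformity :: (ell2 \<times> ell2) filter) = (INF e\<in>{0 <..}. principal {(x, y). dist x y < e})"
    by (rule uniformity_ell2_def)
  show "open U \<longleftrightarrow> (\<forall>x\<in>U. eventually (\<lambda>(x', y). x' = x \<longrightarrow> y \<in> U) uniformity)"
    by (rule open_ell2_def)
  show "inner x y = inner y x"
  proof transfer
    fix x y :: "nat \<Rightarrow> complex"
    assume "summable (\<lambda>n. (norm (x n))\<^sup>2)" "summable (\<lambda>n. (norm (y n))\<^sup>2)"
    then have "summable (\<lambda>n. y n * cnj (x n))" by (intro summable_cinner_aux)
    then have "cnj (\<Sum>n. y n * cnj (x n)) = (\<Sum>n. cnj (y n * cnj (x n)))"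
      by (rule bounded_linear.suminf[OF bounded_linear_cnj])
    then show "Re (\<Sum>n. x n * cnj (y n)) = Re (\<Sum>n. y n * cnj (x n))"
      by (metis (no_types, lifting) cnj.sel(1) complex_cnj_cnj complex_cnj_mult mult.commute suminf_cong)
  qed
  show "inner (x + y) z = inner x z + inner y z"
    by transfer (simp add: distrib_right suminf_add[symmetric] summable_cinner_aux)
  show "inner (r *\<^sub>R x) y = r * inner x y"
    by transfer (simp add: mult.assoc suminf_mult summable_cinner_aux)
  show "0 \<le> inner x x"
    by transfer (simp add: inner_self_aux suminf_nonneg)
  show "inner x x = 0 \<longleftrightarrow> x = 0"
    by transfer (simp add: inner_self_aux suminf_eq_zero_iff fun_eq_iff)
  show "norm x = sqrt (inner x x)"
    by transfer (simp add: inner_self_aux)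
qed

end

lemma norm_ell2_sq: "(norm x)\<^sup>2 = (\<Sum>n. (norm (ell2_nth x n))\<^sup>2)"
  by (simp add: norm_ell2.rep_eq suminf_nonneg summable_ell2)

lemma sum_le_norm_ell2_sq: "(\<Sum>n<m. (norm (ell2_nth x n))\<^sup>2) \<le> (norm x)\<^sup>2"
  unfolding norm_ell2_sq by (intro sum_le_suminf summable_ell2) auto

lemma ell2_of_bounded_sums:
  assumes "\<And>m. (\<Sum>n<m. (norm (y n))\<^sup>2) \<le> B\<^sup>2" "0 \<le> B"
  shows "summable (\<lambda>n. (norm (y n :: complex))\<^sup>2)"
    and "norm (Abs_ell2 y) \<le> B"
proof -
  show s: "summable (\<lambda>n. (norm (y n))\<^sup>2)"
    by (rule summableI_nonneg_bounded[where x = "B\<^sup>2"]) (use assms in auto)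
  have "(\<Sum>n. (norm (y n))\<^sup>2) \<le> B\<^sup>2"
    by (rule suminf_le_const[OF s]) (use assms in auto)
  then have "(norm (Abs_ell2 y))\<^sup>2 \<le> B\<^sup>2"
    by (simp add: norm_ell2_sq Abs_ell2_inverse s)
  then show "norm (Abs_ell2 y) \<le> B" using assms(2) by (rule power2_le_imp_le)
qed

section \<open>Bounded operators\<close>

lemma bounded_linear_ell2I:
  assumes "\<And>x y. f (x + y) = f x + f y" "\<And>r x. f (r *\<^sub>R x) = r *\<^sub>R f x"
    and "\<And>x m. (\<Sum>n<m. (norm (ell2_nth (f x) n))\<^sup>2) \<le> (K * norm x)\<^sup>2" "0 \<le> K"
  shows "bounded_linear f"
proof (rule bounded_linear_intro[where K = K])
  show "norm (f x) \<le> norm x * K" for x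
    using ell2_of_bounded_sums(2)[of "ell2_nth (f x)" "K * norm x"] assms(3,4)
    by (simp add: ell2_nth_inverse mult.commute)
qed (use assms in auto)

lift_definition cscale_op :: "complex \<Rightarrow> ell2 \<Rightarrow>\<^sub>L ell2" is scaleC_ell2
proof (rule bounded_linear_ell2I)
  fix c :: complex
  show "(\<Sum>n<m. (norm (ell2_nth (scaleC_ell2 c x) n))\<^sup>2) \<le> (norm c * norm x)\<^sup>2" for x m
    using mult_left_mono[OF sum_le_norm_ell2_sq[of x m], of "(norm c)\<^sup>2"]
    by (simp add: scaleC_ell2.rep_eq norm_mult power_mult_distrib sum_distrib_left)
qed (transfer; simp add: algebra_simps)+

text \<open>
  \<open>ell2 \<Rightarrow>\<^sub>L ell2\<close> is the type of bounded \<^emph>\<open>real\<close>-linear maps. Its operator norm, addition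
  and composition are used throughout, restricted to the complex-linear maps.
\<close>

definition L_ell2 :: "(ell2 \<Rightarrow>\<^sub>L ell2) set" where
  "L_ell2 = {A. \<forall>c x. blinfun_apply A (scaleC_ell2 c x) = scaleC_ell2 c (blinfun_apply A x)}"

definition scaleC_op :: "complex \<Rightarrow> (ell2 \<Rightarrow>\<^sub>L ell2) \<Rightarrow> (ell2 \<Rightarrow>\<^sub>L ell2)" where
  "scaleC_op c A = cscale_op c o\<^sub>L A"

text \<open>Well defined on complex-linear operators, see \<open>cinner_adj\<close> and \<open>adj_eqI\<close> below.\<close>

definition adj :: "(ell2 \<Rightarrow>\<^sub>L ell2) \<Rightarrow> (ell2 \<Rightarrow>\<^sub>L ell2)" where
  "adj A = (THE B. \<forall>x y. cinner_ell2 (blinfun_apply A x) y = cinner_ell2 x (blinfun_apply B y))"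

lift_definition proj_ell2 :: "nat \<Rightarrow> ell2 \<Rightarrow> ell2" is "\<lambda>n x m. if m < n then x m else 0"
  subgoal for n x by (rule summable_comparison_test'[where g = "\<lambda>m. (norm (x m))\<^sup>2"]) auto
  done

lift_definition proj_op :: "nat \<Rightarrow> ell2 \<Rightarrow>\<^sub>L ell2" is proj_ell2
proof (rule bounded_linear_ell2I)
  show "(\<Sum>k<m. (norm (ell2_nth (proj_ell2 n x) k))\<^sup>2) \<le> (1 * norm x)\<^sup>2" for n x m
  proof -
    have "(\<Sum>k<m. (norm (ell2_nth (proj_ell2 n x) k))\<^sup>2) \<le> (\<Sum>k<m. (norm (ell2_nth x k))\<^sup>2)"
      by (rule sum_mono) (simp add: proj_ell2.rep_eq)
    also have "\<dots> \<le> (1 * norm x)\<^sup>2"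
      using sum_le_norm_ell2_sq by simp
    finally show ?thesis .
  qed
qed (transfer; force)+

text \<open>For \<open>i < N\<close>: \<open>m = r * N + i\<close> iff \<open>m mod N = i\<close> and \<open>r = m div N\<close>.\<close>

lemma sum_S_le:
  fixes x :: "nat \<Rightarrow> complex"
  shows "(\<Sum>k<m. (norm (if k mod N = i then x (k div N) else 0))\<^sup>2) \<le> (\<Sum>k<m. (norm (x k))\<^sup>2)"
proof -
  let ?K = "{k\<in>{..<m}. k mod N = i}"
  have inj: "inj_on (\<lambda>k. k div N) ?K"
    by (rule inj_onI) (metis (mono_tags, lifting) div_mult_mod_eq mem_Collect_eq)
  have "(\<Sum>k<m. (norm (if k mod N = i then x (k div N) else 0))\<^sup>2)
      = (\<Sum>k\<in>?K. (norm (x (k div N)))\<^sup>2)"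
    by (subst sum.inter_filter) (auto intro!: sum.cong)
  also have "\<dots> = (\<Sum>k\<in>(\<lambda>k. k div N) ` ?K. (norm (x k))\<^sup>2)"
    by (subst sum.reindex[OF inj]) simp
  also have "\<dots> \<le> (\<Sum>k<m. (norm (x k))\<^sup>2)"
    by (rule sum_mono2) (auto intro: le_less_trans[OF div_le_dividend])
  finally show ?thesis .
qed

lift_definition S_ell2 :: "nat \<Rightarrow> nat \<Rightarrow> ell2 \<Rightarrow> ell2" is
  "\<lambda>N i x m. if m mod N = i then x (m div N) else 0"
  subgoal for N i x
    by (rule summableI_nonneg_bounded[where x = "\<Sum>n. (norm (x n))\<^sup>2"])
       (auto intro!: order_trans[OF sum_S_le] sum_le_suminf)
  done

lift_definition S_op :: "nat \<Rightarrow> nat \<Rightarrow> ell2 \<Rightarrow>\<^sub>L ell2" is S_ell2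
proof (rule bounded_linear_ell2I)
  show "(\<Sum>k<m. (norm (ell2_nth (S_ell2 N i x) k))\<^sup>2) \<le> (1 * norm x)\<^sup>2" for N i x m
    using order_trans[OF sum_S_le sum_le_norm_ell2_sq[of x m]] by (simp add: S_ell2.rep_eq)
qed (transfer; force)+

lemma S_op_nth: "i < N \<Longrightarrow> ell2_nth (S_op N i x) (r * N + i) = ell2_nth x r"
  by (simp add: S_op.rep_eq S_ell2.rep_eq)

section \<open>Adjoints\<close>

lemma scaleC_ell2_of_real: "scaleC_ell2 (of_real r) x = r *\<^sub>R x"
  by transfer simp

lemma summable_cinner: "summable (\<lambda>n. ell2_nth x n * cnj (ell2_nth y n))"
  by (rule summable_cinner_aux) (rule summable_ell2)+

lemma inner_eq_Re_cinner: "inner x y = Re (cinner_ell2 x y)"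
  by transfer simp

lemma cinner_self: "cinner_ell2 x x = of_real ((norm x)\<^sup>2)"
  unfolding norm_ell2_sq cinner_ell2.rep_eq by (rule inner_self_aux[OF summable_ell2])

lemma cinner_add_left: "cinner_ell2 (x + y) z = cinner_ell2 x z + cinner_ell2 y z"
  by transfer (simp add: distrib_right suminf_add[symmetric] summable_cinner_aux)

lemma cinner_scaleC_left: "cinner_ell2 (scaleC_ell2 c x) y = c * cinner_ell2 x y"
  by transfer (simp add: mult.assoc suminf_mult summable_cinner_aux)

lemma cinner_commute: "cinner_ell2 x y = cnj (cinner_ell2 y x)"
proof -
  have "cnj (\<Sum>n. ell2_nth y n * cnj (ell2_nth x n)) = (\<Sum>n. cnj (ell2_nth y n * cnj (ell2_nth x n)))"
    by (rule bounded_linear.suminf[OF bounded_linear_cnj summable_cinner])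
  then show ?thesis by (simp add: cinner_ell2.rep_eq mult.commute)
qed

lemma cinner_add_right: "cinner_ell2 z (x + y) = cinner_ell2 z x + cinner_ell2 z y"
  by (metis cinner_add_left cinner_commute complex_cnj_add)

lemma cinner_scaleC_right: "cinner_ell2 x (scaleC_ell2 c y) = cnj c * cinner_ell2 x y"
  by (metis cinner_scaleC_left cinner_commute complex_cnj_mult)

lemma norm_scaleC: "norm (scaleC_ell2 c x) = norm c * norm x"
proof -
  have "(norm (scaleC_ell2 c x))\<^sup>2 = (norm c * norm x)\<^sup>2"
    unfolding norm_ell2_sq power_mult_distrib
    by (simp add: scaleC_ell2.rep_eq norm_mult power_mult_distrib suminf_mult summable_ell2)
  then show ?thesis by (simp add: power2_eq_iff_nonneg)
qed

lemma norm_cinner_le: "norm (cinner_ell2 x y) \<le> norm x * norm y"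
proof (cases "cinner_ell2 x y = 0")
  case False
  define u where "u = cnj (sgn (cinner_ell2 x y))"
  have u: "norm u = 1" using False by (simp add: u_def norm_sgn)
  have "u * cinner_ell2 x y = of_real (norm (cinner_ell2 x y))"
    using False by (simp add: u_def sgn_eq complex_norm_square[symmetric] field_simps power2_eq_square)
  then have "norm (cinner_ell2 x y) = inner (scaleC_ell2 u x) y"
    by (simp add: inner_eq_Re_cinner cinner_scaleC_left)
  also have "\<dots> \<le> norm (scaleC_ell2 u x) * norm y" by (rule norm_cauchy_schwarz)
  finally show ?thesis by (simp add: norm_scaleC u)
qed simp

lemma cinner_eq_imp_eq:
  assumes "\<And>x. cinner_ell2 x y = cinner_ell2 x z"
  shows "y = z"
proof -
  have "inner x (y - z) = 0" for x
    using assms[of x] by (simp only: inner_diff_right) (simp add: inner_eq_Re_cinner)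
  then have "inner (y - z) (y - z) = 0" .
  then show ?thesis by simp
qed

lift_definition basis_ell2 :: "nat \<Rightarrow> ell2" is "\<lambda>n m. if m = n then 1 else 0"
  subgoal for n using summable_finite[of "{n}" "\<lambda>m. (norm (if m = n then 1 else (0::complex)))\<^sup>2"] by simp
  done

lemma proj_Suc: "proj_ell2 (Suc n) x = proj_ell2 n x + scaleC_ell2 (ell2_nth x n) (basis_ell2 n)"
  by (rule ell2_eqI)
     (simp add: proj_ell2.rep_eq plus_ell2.rep_eq scaleC_ell2.rep_eq basis_ell2.rep_eq less_Suc_eq)

lemma proj_tendsto: "(\<lambda>n. proj_ell2 n x) \<longlonglongrightarrow> x"
proof (rule Lim_null[THEN iffD2], rule tendsto_norm_zero_cancel)
  have "(norm (proj_ell2 n x - x))\<^sup>2 = (norm x)\<^sup>2 - (\<Sum>k<n. (norm (ell2_nth x k))\<^sup>2)" for n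
  proof -
    have "(norm (proj_ell2 n x - x))\<^sup>2 = (\<Sum>k. if k < n then 0 else (norm (ell2_nth x k))\<^sup>2)"
      unfolding norm_ell2_sq by (intro suminf_cong) (simp add: minus_ell2.rep_eq proj_ell2.rep_eq)
    also have "\<dots> = (\<Sum>k. (norm (ell2_nth x k))\<^sup>2 - (if k < n then (norm (ell2_nth x k))\<^sup>2 else 0))"
      by (intro suminf_cong) simp
    also have "\<dots> = (norm x)\<^sup>2 - (\<Sum>k. if k < n then (norm (ell2_nth x k))\<^sup>2 else 0)"
      unfolding norm_ell2_sq
      by (intro suminf_diff[symmetric] summable_ell2 summable_finite[of "{..<n}"]) auto
    also have "(\<Sum>k. if k < n then (norm (ell2_nth x k))\<^sup>2 else 0) = (\<Sum>k<n. (norm (ell2_nth x k))\<^sup>2)"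
      by (subst suminf_finite[of "{..<n}"]) auto
    finally show ?thesis .
  qed
  moreover have "(\<lambda>n. (norm x)\<^sup>2 - (\<Sum>k<n. (norm (ell2_nth x k))\<^sup>2)) \<longlonglongrightarrow> (norm x)\<^sup>2 - (norm x)\<^sup>2"
    unfolding norm_ell2_sq by (intro tendsto_diff tendsto_const summable_LIMSEQ summable_ell2)
  ultimately have "(\<lambda>n. (norm (proj_ell2 n x - x))\<^sup>2) \<longlonglongrightarrow> 0" by simp
  then have "(\<lambda>n. sqrt ((norm (proj_ell2 n x - x))\<^sup>2)) \<longlonglongrightarrow> sqrt 0" by (rule tendsto_real_sqrt)
  then show "(\<lambda>n. norm (proj_ell2 n x - x)) \<longlonglongrightarrow> 0" by simp
qed

lemma blinfun_proj_sums:
  assumes A: "A \<in> L_ell2"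
  shows "cinner_ell2 (A (proj_ell2 n x)) y
    = (\<Sum>k<n. ell2_nth x k * cinner_ell2 (A (basis_ell2 k)) y)"
proof (induction n)
  case 0
  have "proj_ell2 0 x = 0" by transfer simp
  moreover have "cinner_ell2 0 y = 0" by transfer simp
  ultimately show ?case by simp
next
  case (Suc n)
  then show ?case using A
    by (simp add: proj_Suc blinfun.add_right cinner_add_left L_ell2_def cinner_scaleC_left)
qed

lemma cinner_blinfun_sums:
  assumes A: "A \<in> L_ell2"
  shows "(\<lambda>k. ell2_nth x k * cinner_ell2 (A (basis_ell2 k)) y) sums cinner_ell2 (A x) y"
proof -
  let ?s = "\<lambda>n. \<Sum>k<n. ell2_nth x k * cinner_ell2 (A (basis_ell2 k)) y"
  have bound: "norm (?s n - cinner_ell2 (A x) y) \<le> norm (A (proj_ell2 n x) - A x) * norm y" for n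
  proof -
    have "cinner_ell2 (A (proj_ell2 n x) - A x) y + cinner_ell2 (A x) y
        = cinner_ell2 (A (proj_ell2 n x)) y"
      by (subst cinner_add_left[symmetric]) simp
    then have "?s n - cinner_ell2 (A x) y = cinner_ell2 (A (proj_ell2 n x) - A x) y"
      unfolding blinfun_proj_sums[OF A, symmetric] by (simp add: algebra_simps)
    then show ?thesis using norm_cinner_le by simp
  qed
  have "(\<lambda>n. A (proj_ell2 n x)) \<longlonglongrightarrow> A x"
    by (rule bounded_linear.tendsto[OF blinfun.bounded_linear_right proj_tendsto])
  then have "(\<lambda>n. norm (A (proj_ell2 n x) - A x)) \<longlonglongrightarrow> 0"
    by (intro tendsto_norm_zero) (rule Lim_null[THEN iffD1])
  then have "(\<lambda>n. norm (A (proj_ell2 n x) - A x) * norm y) \<longlonglongrightarrow> 0"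
    by (rule tendsto_mult_left_zero)
  then have "(\<lambda>n. ?s n - cinner_ell2 (A x) y) \<longlonglongrightarrow> 0"
    by (rule Lim_null_comparison[rotated]) (simp add: bound)
  then have "?s \<longlonglongrightarrow> cinner_ell2 (A x) y"
    by (rule Lim_null[THEN iffD2])
  then show ?thesis unfolding sums_def .
qed

lemma adjoint_exists:
  assumes A: "A \<in> L_ell2"
  shows "\<exists>B. \<forall>x y. cinner_ell2 (A x) y = cinner_ell2 x (blinfun_apply B y)"
proof -
  define w where "w = (\<lambda>y n. cnj (cinner_ell2 (A (basis_ell2 n)) y))"
  have w_bound: "(\<Sum>n<m. (norm (w y n))\<^sup>2) \<le> (norm A * norm y)\<^sup>2" for y m
  proof -
    define s where "s = (\<Sum>n<m. (norm (w y n))\<^sup>2)"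
    have s0: "0 \<le> s" by (simp add: s_def sum_nonneg)
    have "summable (\<lambda>n. (norm (if n < m then w y n else 0))\<^sup>2)"
      by (rule summable_finite[of "{..<m}"]) auto
    then have v: "ell2_nth (Abs_ell2 (\<lambda>n. if n < m then w y n else 0))
        = (\<lambda>n. if n < m then w y n else 0)" (is "ell2_nth ?v = _")
      by (intro Abs_ell2_inverse) simp
    define v where "v = ?v"
    note v = v[folded v_def]
    have "proj_ell2 m v = v" by (rule ell2_eqI) (simp add: proj_ell2.rep_eq v)
    then have "cinner_ell2 (A v) y = (\<Sum>k<m. w y k * cnj (w y k))"
      using blinfun_proj_sums[OF A, of m v y] by (simp add: v w_def)
    also have "\<dots> = of_real s" by (simp only: s_def of_real_sum complex_norm_square)
    finally have "s \<le> norm (A v) * norm y"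
      using norm_cinner_le[of "A v" y] s0 by simp
    also have "\<dots> \<le> norm A * norm v * norm y" by (intro mult_right_mono norm_blinfun) auto
    also have "norm v = sqrt s"
    proof -
      have "(norm v)\<^sup>2 = s" unfolding norm_ell2_sq s_def
        by (subst suminf_finite[of "{..<m}"]) (auto simp: v)
      then show ?thesis by (rule real_sqrt_unique[symmetric]) simp
    qed
    finally have "sqrt s * sqrt s \<le> (norm A * norm y) * sqrt s" using s0 by (simp add: mult_ac)
    then have "sqrt s \<le> norm A * norm y"
      using s0 by (cases "s = 0") (simp_all only: mult_le_cancel_right, auto)
    then have "(sqrt s)\<^sup>2 \<le> (norm A * norm y)\<^sup>2" by (intro power_mono) (auto simp: s0)
    then show ?thesis using s0 by (simp add: s_def)
  qed
  have w_summable: "summable (\<lambda>n. (norm (w y n))\<^sup>2)" for y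
    using ell2_of_bounded_sums(1)[of "w y" "norm A * norm y"] w_bound by simp
  define f where "f = (\<lambda>y. Abs_ell2 (w y))"
  have f: "ell2_nth (f y) n = w y n" for y n
    by (simp add: f_def Abs_ell2_inverse w_summable)
  have "bounded_linear f"
  proof (rule bounded_linear_ell2I)
    show "f (x + y) = f x + f y" for x y
      by (rule ell2_eqI) (simp add: f plus_ell2.rep_eq w_def cinner_add_right)
    show "f (r *\<^sub>R x) = r *\<^sub>R f x" for r x
      by (rule ell2_eqI)
         (simp add: f scaleC_ell2.rep_eq w_def cinner_scaleC_right scaleC_ell2_of_real[symmetric])
    show "(\<Sum>n<m. (norm (ell2_nth (f x) n))\<^sup>2) \<le> (norm A * norm x)\<^sup>2" for x m
      using w_bound by (simp add: f)
  qed simp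
  then have "blinfun_apply (Blinfun f) = f" by (rule bounded_linear_Blinfun_apply)
  moreover have "cinner_ell2 (A x) y = cinner_ell2 x (f y)" for x y
    using sums_unique[OF cinner_blinfun_sums[OF A, of x y]]
    by (simp add: cinner_ell2.rep_eq f w_def)
  ultimately show ?thesis by (intro exI[of _ "Blinfun f"]) simp
qed

lemma cinner_adj:
  assumes A: "A \<in> L_ell2"
  shows "cinner_ell2 (A x) y = cinner_ell2 x (adj A y)"
proof -
  obtain B where B: "\<And>x y. cinner_ell2 (A x) y = cinner_ell2 x (blinfun_apply B y)"
    using adjoint_exists[OF A] by blast
  have "adj A = B" unfolding adj_def
  proof (rule the_equality)
    fix C :: "ell2 \<Rightarrow>\<^sub>L ell2"
    assume C: "\<forall>x y. cinner_ell2 (A x) y = cinner_ell2 x (C y)"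
    have "cinner_ell2 x (C y) = cinner_ell2 x (B y)" for x y
      using C B by simp
    then show "C = B" by (intro blinfun_eqI cinner_eq_imp_eq)
  qed (use B in blast)
  then show ?thesis using B by simp
qed

lemma adj_eqI:
  assumes "A \<in> L_ell2" "\<And>x y. cinner_ell2 (A x) y = cinner_ell2 x (blinfun_apply B y)"
  shows "adj A = B"
proof (intro blinfun_eqI cinner_eq_imp_eq)
  fix x y
  show "cinner_ell2 x (adj A y) = cinner_ell2 x (B y)"
    using cinner_adj[OF assms(1), of x y] assms(2)[of x y] by simp
qed

lemma adj_in_L: "A \<in> L_ell2 \<Longrightarrow> adj A \<in> L_ell2"
  by (subst L_ell2_def, intro CollectI allI cinner_eq_imp_eq)
     (simp add: cinner_adj[symmetric] cinner_scaleC_right)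

lemma norm_adj_le:
  assumes "A \<in> L_ell2"
  shows "norm (adj A) \<le> norm A"
proof (rule norm_blinfun_bound)
  fix y
  have "of_real ((norm (adj A y))\<^sup>2) = cinner_ell2 (A (adj A y)) y"
    by (simp only: cinner_adj[OF assms] cinner_self)
  then have "(norm (adj A y))\<^sup>2 = norm (cinner_ell2 (A (adj A y)) y)"
    by (metis abs_of_nonneg norm_of_real zero_le_power2)
  also have "\<dots> \<le> norm (A (adj A y)) * norm y" by (rule norm_cinner_le)
  also have "\<dots> \<le> norm A * norm (adj A y) * norm y" by (intro mult_right_mono norm_blinfun) auto
  finally have "norm (adj A y) * norm (adj A y) \<le> (norm A * norm y) * norm (adj A y)"
    by (simp add: power2_eq_square mult_ac)
  then show "norm (adj A y) \<le> norm A * norm y"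
    by (cases "norm (adj A y) = 0") (simp_all only: mult_le_cancel_right, auto)
qed simp

section \<open>The concrete Cuntz algebra\<close>

definition cstar_subalgebra_L :: "(ell2 \<Rightarrow>\<^sub>L ell2) set \<Rightarrow> bool" where
  "cstar_subalgebra_L S \<longleftrightarrow>
     S \<subseteq> L_ell2 \<and> 0 \<in> S \<and>
     (\<forall>A\<in>S. \<forall>B\<in>S. A + B \<in> S \<and> A o\<^sub>L B \<in> S) \<and>
     (\<forall>c. \<forall>A\<in>S. scaleC_op c A \<in> S) \<and>
     (\<forall>A\<in>S. adj A \<in> S) \<and>
     closed S"

lemma L_I: "(\<And>c x. blinfun_apply A (scaleC_ell2 c x) = scaleC_ell2 c (A x)) \<Longrightarrow> A \<in> L_ell2"
  by (simp add: L_ell2_def)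

lemma L_D: "A \<in> L_ell2 \<Longrightarrow> blinfun_apply A (scaleC_ell2 c x) = scaleC_ell2 c (A x)"
  by (simp add: L_ell2_def)

lemma proj_op_in_L: "proj_op n \<in> L_ell2"
  by (rule L_I, rule ell2_eqI) (simp add: proj_op.rep_eq proj_ell2.rep_eq scaleC_ell2.rep_eq)

lemma S_op_in_L: "S_op N i \<in> L_ell2"
  by (rule L_I, rule ell2_eqI) (simp add: S_op.rep_eq S_ell2.rep_eq scaleC_ell2.rep_eq)

lemma comp_in_L: "A \<in> L_ell2 \<Longrightarrow> B \<in> L_ell2 \<Longrightarrow> A o\<^sub>L B \<in> L_ell2"
  by (rule L_I) (simp add: L_D)

lemma scaleC_ell2_commute: "scaleC_ell2 c (scaleC_ell2 d x) = scaleC_ell2 d (scaleC_ell2 c x)"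
  by transfer (simp add: mult_ac)

lemma scaleC_op_in_L: "A \<in> L_ell2 \<Longrightarrow> scaleC_op c A \<in> L_ell2"
  unfolding scaleC_op_def
  by (rule comp_in_L[OF L_I]) (simp_all add: cscale_op.rep_eq scaleC_ell2_commute)

lemma scaleC_ell2_add: "scaleC_ell2 c (x + y) = scaleC_ell2 c x + scaleC_ell2 c y"
  by transfer (simp add: algebra_simps)

lemma add_in_L: "A \<in> L_ell2 \<Longrightarrow> B \<in> L_ell2 \<Longrightarrow> A + B \<in> L_ell2"
  by (rule L_I) (simp add: L_D blinfun.add_left scaleC_ell2_add)

lemma zero_in_L: "0 \<in> L_ell2"
  by (rule L_I) (simp flip: cscale_op.rep_eq add: blinfun.zero_right)

lemma closed_L_ell2: "closed L_ell2"
proof -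
  have "L_ell2 = (\<Inter>c. \<Inter>x. {A. blinfun_apply A (scaleC_ell2 c x) = cscale_op c (A x)})"
    by (auto simp: L_ell2_def cscale_op.rep_eq)
  also have "closed \<dots>"
    by (intro closed_INT ballI closed_Collect_eq continuous_intros)
  finally show ?thesis .
qed

lemma cstar_subalgebra_L_ell2: "cstar_subalgebra_L L_ell2"
  unfolding cstar_subalgebra_L_def
  by (auto intro: add_in_L comp_in_L scaleC_op_in_L adj_in_L closed_L_ell2 zero_in_L)

text \<open>The intersection is a C*-algebra, see \<open>cstar_subalgebra_L_cuntz\<close> below.\<close>

definition cuntz :: "nat \<Rightarrow> (ell2 \<Rightarrow>\<^sub>L ell2) set" where
  "cuntz N = \<Inter>{S. cstar_subalgebra_L S \<and> S_op N ` {0..<N} \<subseteq> S}"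

lemma cstar_subalgebra_L_cuntz: "cstar_subalgebra_L (cuntz N)"
proof -
  have "cuntz N \<subseteq> L_ell2"
    unfolding cuntz_def using cstar_subalgebra_L_ell2 by (intro Inter_lower) (auto simp: S_op_in_L)
  moreover have "closed (cuntz N)"
    unfolding cuntz_def by (rule closed_Inter) (auto simp: cstar_subalgebra_L_def)
  ultimately show ?thesis
    unfolding cstar_subalgebra_L_def[of "cuntz N"]
    by (auto simp: cuntz_def cstar_subalgebra_L_def)
qed

section \<open>Matrix sequences and finite sections\<close>

text \<open>
  A matrix of size \<open>\<eta> n\<close>, i.e. an operator on the range of \<open>proj_op (\<eta> n)\<close>, is
  represented by its extension by zero to the whole space; this preserves all operations and the norm.
\<close>

type_synonym opseq = "nat \<Rightarrow> (ell2 \<Rightarrow>\<^sub>L ell2)"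

definition F_alg :: "(nat \<Rightarrow> nat) \<Rightarrow> opseq set" where
  "F_alg \<eta> = {A. (\<forall>n. A n \<in> L_ell2 \<and> proj_op (\<eta> n) o\<^sub>L A n o\<^sub>L proj_op (\<eta> n) = A n) \<and>
                 bounded (range A)}"

definition G_ideal :: "(nat \<Rightarrow> nat) \<Rightarrow> opseq set" where
  "G_ideal \<eta> = {A \<in> F_alg \<eta>. (\<lambda>n. norm (A n)) \<longlonglongrightarrow> 0}"

definition sup_norm :: "opseq \<Rightarrow> real" where
  "sup_norm A = (SUP n. norm (A n))"

definition cstar_subalgebra_F :: "(nat \<Rightarrow> nat) \<Rightarrow> opseq set \<Rightarrow> bool" where
  "cstar_subalgebra_F \<eta> S \<longleftrightarrow>
     S \<subseteq> F_alg \<eta> \<and> (\<lambda>_. 0) \<in> S \<and>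
     (\<forall>A\<in>S. \<forall>B\<in>S. (\<lambda>n. A n + B n) \<in> S \<and> (\<lambda>n. A n o\<^sub>L B n) \<in> S) \<and>
     (\<forall>c. \<forall>A\<in>S. (\<lambda>n. scaleC_op c (A n)) \<in> S) \<and>
     (\<forall>A\<in>S. (\<lambda>n. adj (A n)) \<in> S) \<and>
     (\<forall>X. \<forall>A\<in>F_alg \<eta>. (\<forall>k. X k \<in> S) \<and>
        (\<lambda>k. sup_norm (\<lambda>n. X k n - A n)) \<longlonglongrightarrow> 0 \<longrightarrow> A \<in> S)"

definition finite_sections :: "(nat \<Rightarrow> nat) \<Rightarrow> (ell2 \<Rightarrow>\<^sub>L ell2) \<Rightarrow> opseq" where
  "finite_sections \<eta> A = (\<lambda>n. proj_op (\<eta> n) o\<^sub>L A o\<^sub>L proj_op (\<eta> n))"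

definition S_alg :: "(nat \<Rightarrow> nat) \<Rightarrow> (ell2 \<Rightarrow>\<^sub>L ell2) set \<Rightarrow> opseq set" where
  "S_alg \<eta> C = \<Inter>{S. cstar_subalgebra_F \<eta> S \<and> finite_sections \<eta> ` C \<subseteq> S}"

lemma op_assoc: "A o\<^sub>L B o\<^sub>L C = A o\<^sub>L (B o\<^sub>L (C :: ell2 \<Rightarrow>\<^sub>L ell2))"
  by (rule blinfun_eqI) simp

lemma op_add_distrib:
  fixes A B C :: "ell2 \<Rightarrow>\<^sub>L ell2"
  shows "(A + B) o\<^sub>L C = (A o\<^sub>L C) + (B o\<^sub>L C)" "C o\<^sub>L (A + B) = (C o\<^sub>L A) + (C o\<^sub>L B)"
  by (rule blinfun_eqI, simp add: blinfun.add_left blinfun.add_right)+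

lemma op_zero: "0 o\<^sub>L (C :: ell2 \<Rightarrow>\<^sub>L ell2) = (0 :: ell2 \<Rightarrow>\<^sub>L ell2)"
    "(C :: ell2 \<Rightarrow>\<^sub>L ell2) o\<^sub>L (0 :: ell2 \<Rightarrow>\<^sub>L ell2) = 0"
  by (rule blinfun_eqI, simp add: blinfun.zero_right)+

lemma proj_idem: "proj_op n o\<^sub>L proj_op n = proj_op n"
  by (rule blinfun_eqI, rule ell2_eqI) (simp add: proj_op.rep_eq proj_ell2.rep_eq)

lemma adj_proj: "adj (proj_op n) = proj_op n"
proof (rule adj_eqI[OF proj_op_in_L])
  show "cinner_ell2 (proj_op n x) y = cinner_ell2 x (proj_op n y)" for x y
    unfolding cinner_ell2.rep_eq
    by (intro suminf_cong) (simp add: proj_op.rep_eq proj_ell2.rep_eq)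
qed

lemma adj_comp:
  assumes "A \<in> L_ell2" "B \<in> L_ell2"
  shows "adj (A o\<^sub>L B) = adj B o\<^sub>L adj A"
  by (rule adj_eqI) (simp_all add: assms comp_in_L cinner_adj)

lemma norm_proj_le: "norm (proj_op n) \<le> 1"
proof (rule norm_blinfun_bound)
  fix x
  have "(norm (proj_op n x))\<^sup>2 \<le> (norm x)\<^sup>2"
    unfolding norm_ell2_sq
    by (intro suminf_le summable_ell2) (simp add: proj_op.rep_eq proj_ell2.rep_eq)
  then show "norm (proj_op n x) \<le> 1 * norm x" by simp
qed simp

lemma F_alg_I:
  assumes "\<And>n. A n \<in> L_ell2" "\<And>n. proj_op (\<eta> n) o\<^sub>L A n = A n" "\<And>n. A n o\<^sub>L proj_op (\<eta> n) = A n"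
    and "\<And>n. norm (A n) \<le> B"
  shows "A \<in> F_alg \<eta>"
  using assms unfolding F_alg_def bounded_iff by auto

lemma F_alg_D:
  assumes "A \<in> F_alg \<eta>"
  shows "A n \<in> L_ell2" "proj_op (\<eta> n) o\<^sub>L A n = A n" "A n o\<^sub>L proj_op (\<eta> n) = A n"
    and "\<exists>B. \<forall>n. norm (A n) \<le> B"
proof -
  show "A n \<in> L_ell2" using assms by (simp add: F_alg_def)
  have eq: "A n = proj_op (\<eta> n) o\<^sub>L A n o\<^sub>L proj_op (\<eta> n)" using assms by (simp add: F_alg_def)
  show "proj_op (\<eta> n) o\<^sub>L A n = A n"
  proof -
    have "proj_op (\<eta> n) o\<^sub>L A n = proj_op (\<eta> n) o\<^sub>L (proj_op (\<eta> n) o\<^sub>L A n o\<^sub>L proj_op (\<eta> n))"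
      by (subst eq[symmetric]) (rule refl)
    also have "\<dots> = (proj_op (\<eta> n) o\<^sub>L proj_op (\<eta> n)) o\<^sub>L A n o\<^sub>L proj_op (\<eta> n)"
      by (simp only: op_assoc)
    finally show ?thesis by (simp only: proj_idem eq[symmetric])
  qed
  show "A n o\<^sub>L proj_op (\<eta> n) = A n"
  proof -
    have "A n o\<^sub>L proj_op (\<eta> n) = (proj_op (\<eta> n) o\<^sub>L A n o\<^sub>L proj_op (\<eta> n)) o\<^sub>L proj_op (\<eta> n)"
      by (subst eq[symmetric]) (rule refl)
    also have "\<dots> = proj_op (\<eta> n) o\<^sub>L A n o\<^sub>L (proj_op (\<eta> n) o\<^sub>L proj_op (\<eta> n))"
      by (simp only: op_assoc)
    finally show ?thesis by (simp only: proj_idem eq[symmetric])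
  qed
  show "\<exists>B. \<forall>n. norm (A n) \<le> B" using assms by (auto simp: F_alg_def bounded_iff)
qed

lemma norm_cscale_op_le: "norm (cscale_op c) \<le> norm c"
  by (rule norm_blinfun_bound) (simp_all add: cscale_op.rep_eq norm_scaleC)

lemma cstar_subalgebra_F_alg: "cstar_subalgebra_F \<eta> (F_alg \<eta>)"
  unfolding cstar_subalgebra_F_def
proof (intro conjI ballI allI impI subset_refl)
  show "(\<lambda>_. 0) \<in> F_alg \<eta>"
    by (rule F_alg_I[where B = 0])
       (simp_all add: zero_in_L op_zero)
next
  fix A B assume A: "A \<in> F_alg \<eta>" and B: "B \<in> F_alg \<eta>"
  obtain a where a: "\<And>n. norm (A n) \<le> a" using F_alg_D(4)[OF A] by blast
  obtain b where b: "\<And>n. norm (B n) \<le> b" using F_alg_D(4)[OF B] by blast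
  show "(\<lambda>n. A n + B n) \<in> F_alg \<eta>"
  proof (rule F_alg_I[where B = "a + b"])
    show "norm (A n + B n) \<le> a + b" for n by (rule norm_triangle_mono[OF a b])
  qed (simp_all add: add_in_L F_alg_D(1)[OF A] F_alg_D(1)[OF B] op_add_distrib
        F_alg_D(2,3)[OF A] F_alg_D(2,3)[OF B])
  show "(\<lambda>n. A n o\<^sub>L B n) \<in> F_alg \<eta>"
  proof (rule F_alg_I[where B = "a * b"])
    show "norm (A n o\<^sub>L B n) \<le> a * b" for n
      by (rule order_trans[OF norm_blinfun_compose mult_mono])
         (use a b order_trans[OF norm_ge_zero a] in auto)
    show "proj_op (\<eta> n) o\<^sub>L (A n o\<^sub>L B n) = A n o\<^sub>L B n" for n
      by (simp add: op_assoc[symmetric] F_alg_D(2)[OF A])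
    show "A n o\<^sub>L B n o\<^sub>L proj_op (\<eta> n) = A n o\<^sub>L B n" for n
      by (simp add: op_assoc F_alg_D(3)[OF B])
  qed (simp add: comp_in_L F_alg_D(1)[OF A] F_alg_D(1)[OF B])
next
  fix c A assume A: "A \<in> F_alg \<eta>"
  obtain a where a: "\<And>n. norm (A n) \<le> a" using F_alg_D(4)[OF A] by blast
  show "(\<lambda>n. scaleC_op c (A n)) \<in> F_alg \<eta>"
  proof (rule F_alg_I[where B = "norm c * a"])
    show "norm (scaleC_op c (A n)) \<le> norm c * a" for n
      unfolding scaleC_op_def
      by (rule order_trans[OF norm_blinfun_compose mult_mono[OF norm_cscale_op_le a]]) auto
    have "proj_op k o\<^sub>L cscale_op c = cscale_op c o\<^sub>L proj_op k" for k
      by (rule blinfun_eqI) (simp add: cscale_op.rep_eq L_D[OF proj_op_in_L])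
    then show "proj_op (\<eta> n) o\<^sub>L scaleC_op c (A n) = scaleC_op c (A n)" for n
      unfolding scaleC_op_def
      by (simp only: op_assoc[symmetric]) (simp only: op_assoc F_alg_D(2)[OF A])
    show "scaleC_op c (A n) o\<^sub>L proj_op (\<eta> n) = scaleC_op c (A n)" for n
      unfolding scaleC_op_def by (simp add: op_assoc F_alg_D(3)[OF A])
  qed (simp add: scaleC_op_in_L F_alg_D(1)[OF A])
next
  fix A assume A: "A \<in> F_alg \<eta>"
  obtain a where a: "\<And>n. norm (A n) \<le> a" using F_alg_D(4)[OF A] by blast
  show "(\<lambda>n. adj (A n)) \<in> F_alg \<eta>"
  proof (rule F_alg_I[where B = a])
    show "norm (adj (A n)) \<le> a" for n
      by (rule order_trans[OF norm_adj_le a]) (rule F_alg_D(1)[OF A])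
    show "proj_op (\<eta> n) o\<^sub>L adj (A n) = adj (A n)" for n
      using adj_comp[OF F_alg_D(1)[OF A, of n] proj_op_in_L, of "\<eta> n"] by (simp add: adj_proj F_alg_D(3)[OF A])
    show "adj (A n) o\<^sub>L proj_op (\<eta> n) = adj (A n)" for n
      using adj_comp[OF proj_op_in_L F_alg_D(1)[OF A, of n], of "\<eta> n"] by (simp add: adj_proj F_alg_D(2)[OF A])
  qed (simp add: adj_in_L F_alg_D(1)[OF A])
qed assumption

lemma finite_sections_in_F:
  assumes "A \<in> L_ell2"
  shows "finite_sections \<eta> A \<in> F_alg \<eta>"
proof (rule F_alg_I[where B = "norm A"])
  fix n
  show "norm (finite_sections \<eta> A n) \<le> norm A"
  proof -
    have "norm (proj_op (\<eta> n) o\<^sub>L A o\<^sub>L proj_op (\<eta> n)) \<le> norm (proj_op (\<eta> n) o\<^sub>L A) * norm (proj_op (\<eta> n))"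
      by (rule norm_blinfun_compose)
    also have "\<dots> \<le> norm (proj_op (\<eta> n) o\<^sub>L A) * 1"
      by (intro mult_left_mono norm_proj_le) simp
    also have "\<dots> \<le> norm (proj_op (\<eta> n)) * norm A"
      using norm_blinfun_compose by simp
    also have "\<dots> \<le> 1 * norm A"
      by (intro mult_right_mono norm_proj_le) simp
    finally show ?thesis by (simp add: finite_sections_def)
  qed
  show "proj_op (\<eta> n) o\<^sub>L finite_sections \<eta> A n = finite_sections \<eta> A n"
    by (simp add: finite_sections_def op_assoc[symmetric] proj_idem)
  show "finite_sections \<eta> A n o\<^sub>L proj_op (\<eta> n) = finite_sections \<eta> A n"
    by (simp add: finite_sections_def op_assoc proj_idem)
qed (simp add: finite_sections_def comp_in_L assms proj_op_in_L)

lemma cstar_subalgebra_F_S_alg: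
  assumes "C \<subseteq> L_ell2"
  shows "cstar_subalgebra_F \<eta> (S_alg \<eta> C)"
proof -
  have "S_alg \<eta> C \<subseteq> F_alg \<eta>"
    unfolding S_alg_def using assms cstar_subalgebra_F_alg finite_sections_in_F
    by (intro Inter_lower) auto
  moreover have "A \<in> S_alg \<eta> C"
    if "A \<in> F_alg \<eta>"
      and X: "(\<forall>k. X k \<in> S_alg \<eta> C) \<and> (\<lambda>k. sup_norm (\<lambda>n. X k n - A n)) \<longlonglongrightarrow> 0" for X A
    unfolding S_alg_def
  proof (rule InterI)
    fix S assume S: "S \<in> {S. cstar_subalgebra_F \<eta> S \<and> finite_sections \<eta> ` C \<subseteq> S}"
    then have "\<forall>k. X k \<in> S" using X by (auto simp: S_alg_def)
    then show "A \<in> S" using S that unfolding cstar_subalgebra_F_def by blast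
  qed
  moreover have "(\<lambda>_. 0) \<in> S_alg \<eta> C"
    by (auto simp: S_alg_def cstar_subalgebra_F_def)
  moreover have "(\<lambda>n. A n + B n) \<in> S_alg \<eta> C" "(\<lambda>n. A n o\<^sub>L B n) \<in> S_alg \<eta> C"
      "(\<lambda>n. scaleC_op c (A n)) \<in> S_alg \<eta> C" "(\<lambda>n. adj (A n)) \<in> S_alg \<eta> C"
    if "A \<in> S_alg \<eta> C" "B \<in> S_alg \<eta> C" for A B c
    using that unfolding S_alg_def cstar_subalgebra_F_def Inter_iff mem_Collect_eq by blast+
  ultimately show ?thesis
    unfolding cstar_subalgebra_F_def[of \<eta> "S_alg \<eta> C"]
    by (intro conjI ballI allI impI) assumption+
qed

section \<open>Fractality\<close>

definition restrict_seq :: "(nat \<Rightarrow> nat) \<Rightarrow> opseq \<Rightarrow> opseq" where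
  "restrict_seq \<mu> A = (\<lambda>n. A (\<mu> n))"

text \<open>
  Fractality of a homomorphism \<open>W : S \<rightarrow> B\<close> involves neither the algebraic operations nor the
  norm of \<open>B\<close>, only its underlying set.
\<close>

definition fractal_hom :: "opseq set \<Rightarrow> 'b set \<Rightarrow> (opseq \<Rightarrow> 'b) \<Rightarrow> bool" where
  "fractal_hom S B W \<longleftrightarrow>
     (\<forall>\<mu>. strict_mono \<mu> \<longrightarrow>
        (\<exists>W' \<in> restrict_seq \<mu> ` S \<rightarrow> B. \<forall>A\<in>S. W A = W' (restrict_seq \<mu> A)))"

definition quot_rel :: "(nat \<Rightarrow> nat) \<Rightarrow> opseq set \<Rightarrow> (opseq \<times> opseq) set" where
  "quot_rel \<eta> S = {(A, B). A \<in> S \<and> B \<in> S \<and> (\<lambda>n. A n - B n) \<in> S \<inter> G_ideal \<eta>}"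

definition fractal :: "(nat \<Rightarrow> nat) \<Rightarrow> opseq set \<Rightarrow> bool" where
  "fractal \<eta> S \<longleftrightarrow> cstar_subalgebra_F \<eta> S \<and>
     fractal_hom S (S // quot_rel \<eta> S) (\<lambda>A. quot_rel \<eta> S `` {A})"

end

theory Submission
  imports Defs
begin

text \<open>
  Let \<open>v\<close> insert a new leading digit 1 in front of the base-\<open>N\<close> expansion (with \<open>v 0 = 1\<close>), and let
  \<open>V\<close> be the isometry sending \<open>e\<^sub>r\<close> to the basis vector with index \<open>v r\<close>. Since \<open>S\<^sub>i\<close> only touches the last digit,
  \<open>V\<close> and all its powers commute with \<open>S\<^sub>i\<close> and its adjoint up to an error living on the first \<open>N\<close> basis
  vectors, while \<open>V\<^sup>j\<close> carries the projection \<open>P\<close> of rank \<open>N\<^sup>n\<close> to the one of rank \<open>N\<^sup>n\<^sup>+\<^sup>j\<close>. Hence for every \<open>A\<close>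
  in the algebra of finite sections, \<open>A\<^sub>n\<^sub>+\<^sub>j V\<^sup>j - V\<^sup>j A\<^sub>n\<close> is small on the orthogonal complement of the first
  \<open>m\<close> basis vectors, uniformly in \<open>n\<close> and \<open>j\<close>. If a subsequence of \<open>A\<close> vanishes, then choosing \<open>n + j\<close> in
  it shows that \<open>A\<^sub>n\<close> is uniformly small on that complement. On the span of the first \<open>m\<close> basis vectors
  \<open>A\<^sub>n\<close> tends to 0 because \<open>A\<close> converges strongly. So \<open>A\<close> is a null sequence.
\<close>

section \<open>Operators on basis vectors\<close>

lemma basis_nth: "ell2_nth (basis_ell2 r) k = (if k = r then 1 else 0)"
  by (simp add: basis_ell2.rep_eq)

lemma cinner_basis: "cinner_ell2 x (basis_ell2 r) = ell2_nth x r"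
  unfolding cinner_ell2.rep_eq basis_nth
  by (subst suminf_finite[of "{r}"]) auto

text \<open>Values on basis vectors decide: by \<open>cinner_blinfun_sums\<close> every inner
  product \<open>cinner_ell2 (A y) x\<close> is a convergent series in the terms
  \<open>cinner_ell2 (A (basis_ell2 k)) x\<close>.\<close>

lemma op_eq_zeroI:
  assumes "A \<in> L_ell2" "\<And>r. A (basis_ell2 r) = 0"
  shows "A = 0"
proof (intro blinfun_eqI cinner_eq_imp_eq)
  fix x y
  have "cinner_ell2 0 z = 0" for z by transfer simp
  then have "cinner_ell2 (A y) x = 0" for x y
    using sums_unique[OF cinner_blinfun_sums[OF assms(1), of y x]] assms(2) by simp
  then have "cinner_ell2 x (A y) = 0"
    using cinner_commute by (metis complex_cnj_zero)
  moreover have "cinner_ell2 x 0 = 0" by transfer simp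
  ultimately show "cinner_ell2 x (A y) = cinner_ell2 x (blinfun_apply 0 y)" by simp
qed

lemma proj_op_basis: "proj_op m (basis_ell2 r) = (if r < m then basis_ell2 r else 0)"
  by (rule ell2_eqI) (simp add: proj_op.rep_eq proj_ell2.rep_eq basis_nth zero_ell2.rep_eq)

lemma S_op_basis:
  assumes "i < N"
  shows "S_op N i (basis_ell2 r) = basis_ell2 (r * N + i)"
proof (rule ell2_eqI)
  fix k
  have "(k mod N = i \<and> k div N = r) \<longleftrightarrow> k = r * N + i"
    using assms by (metis div_mult_mod_eq div_mult_self3 div_less add_0_right mod_mult_self3 mod_less
      not_less_zero)
  then show "ell2_nth (S_op N i (basis_ell2 r)) k = ell2_nth (basis_ell2 (r * N + i)) k"
    by (auto simp: S_op.rep_eq S_ell2.rep_eq basis_nth)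
qed

lemma adj_S_op_nth:
  assumes "i < N"
  shows "ell2_nth (adj (S_op N i) x) r = ell2_nth x (r * N + i)"
proof -
  have "cinner_ell2 (basis_ell2 r) (adj (S_op N i) x) = cinner_ell2 (basis_ell2 (r * N + i)) x"
    by (simp only: cinner_adj[OF S_op_in_L, symmetric] S_op_basis[OF assms])
  then show ?thesis
    by (metis cinner_basis cinner_commute)
qed

lemma adj_S_op_basis:
  assumes "i < N"
  shows "adj (S_op N i) (basis_ell2 r) = (if r mod N = i then basis_ell2 (r div N) else 0)"
proof (rule ell2_eqI)
  fix k
  have "(r mod N = i \<and> k = r div N) \<longleftrightarrow> k * N + i = r"
    using assms by (metis div_mult_mod_eq div_mult_self3 div_less add_0_right mod_mult_self3 mod_less
      not_less_zero)
  then show "ell2_nth (adj (S_op N i) (basis_ell2 r)) k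
      = ell2_nth (if r mod N = i then basis_ell2 (r div N) else 0) k"
    by (auto simp: adj_S_op_nth[OF assms] basis_nth zero_ell2.rep_eq)
qed

lemma minus_in_L:
  assumes "A \<in> L_ell2" "B \<in> L_ell2"
  shows "A - B \<in> L_ell2"
proof (rule L_I)
  fix c x
  have "scaleC_ell2 c (u - w) = scaleC_ell2 c u - scaleC_ell2 c w" for u w
    by transfer (simp add: algebra_simps)
  then show "(A - B) (scaleC_ell2 c x) = scaleC_ell2 c ((A - B) x)"
    by (simp add: L_D assms minus_blinfun.rep_eq)
qed

definition coproj_op :: "nat \<Rightarrow> ell2 \<Rightarrow>\<^sub>L ell2" where
  "coproj_op m = id_blinfun - proj_op m"

lemma coproj_op_in_L: "coproj_op m \<in> L_ell2"
  unfolding coproj_op_def by (rule minus_in_L[OF L_I proj_op_in_L]) simp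

lemma coproj_op_basis: "coproj_op m (basis_ell2 r) = (if r < m then 0 else basis_ell2 r)"
  by (simp add: coproj_op_def minus_blinfun.rep_eq proj_op_basis)

lemma norm_coproj_le: "norm (coproj_op m) \<le> 1"
proof (rule norm_blinfun_bound)
  fix x
  have "(norm (coproj_op m x))\<^sup>2 \<le> (norm x)\<^sup>2"
    unfolding norm_ell2_sq
    by (intro suminf_le summable_ell2)
       (simp add: coproj_op_def minus_blinfun.rep_eq minus_ell2.rep_eq proj_op.rep_eq proj_ell2.rep_eq)
  then show "norm (coproj_op m x) \<le> 1 * norm x" by simp
qed simp

text \<open>Supplies the exact zeros from which all tail estimates start.\<close>

lemma comp_coproj_eq_zeroI:
  assumes "A \<in> L_ell2" "\<And>r. m \<le> r \<Longrightarrow> A (basis_ell2 r) = 0"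
  shows "A o\<^sub>L coproj_op m = 0"
  by (rule op_eq_zeroI) (auto simp: comp_in_L assms coproj_op_in_L coproj_op_basis blinfun.zero_right)

lemma op_diff_distrib:
  fixes A B C :: "ell2 \<Rightarrow>\<^sub>L ell2"
  shows "(A - B) o\<^sub>L C = (A o\<^sub>L C) - (B o\<^sub>L C)" "C o\<^sub>L (A - B) = (C o\<^sub>L A) - (C o\<^sub>L B)"
  by (rule blinfun_eqI, simp add: blinfun.diff_left blinfun.diff_right)+

lemma norm_comp_le:
  fixes A B :: "ell2 \<Rightarrow>\<^sub>L ell2"
  assumes "norm A \<le> a" "norm B \<le> b"
  shows "norm (A o\<^sub>L B) \<le> a * b"
  by (rule order_trans[OF norm_blinfun_compose mult_mono])
     (use assms order_trans[OF norm_ge_zero assms(1)] in auto)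

section \<open>Families vanishing uniformly on tails\<close>

text \<open>For a constant family this is compactness of the operator; in general one
  \<open>m\<close> must serve all indices. The free index type covers both sequences and the pairs
  (n, j).\<close>

definition tail_small :: "('i \<Rightarrow> ell2 \<Rightarrow>\<^sub>L ell2) \<Rightarrow> bool" where
  "tail_small X \<longleftrightarrow> (\<forall>e>0. \<exists>m. \<forall>i. norm (X i o\<^sub>L coproj_op m) \<le> e)"

lemma coproj_comp: "m \<le> k \<Longrightarrow> coproj_op m o\<^sub>L coproj_op k = coproj_op k"
  by (rule blinfun_eqI, rule ell2_eqI)
     (simp add: coproj_op_def minus_blinfun.rep_eq minus_ell2.rep_eq proj_op.rep_eq proj_ell2.rep_eq)

text \<open>\<open>coproj_op k\<close> factors through \<open>coproj_op m\<close>, followed by a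
  contraction. Bounds obtained at different cuts therefore hold together at the larger one.\<close>

lemma norm_comp_coproj_antimono:
  fixes X :: "ell2 \<Rightarrow>\<^sub>L ell2"
  assumes "m \<le> k"
  shows "norm (X o\<^sub>L coproj_op k) \<le> norm (X o\<^sub>L coproj_op m)"
proof -
  have "norm ((X o\<^sub>L coproj_op m) o\<^sub>L coproj_op k) \<le> norm (X o\<^sub>L coproj_op m) * 1"
    by (rule norm_comp_le[OF order_refl norm_coproj_le])
  then show ?thesis by (simp add: op_assoc coproj_comp[OF assms])
qed

lemma tail_small_zeroI: "(\<And>i. X i o\<^sub>L coproj_op m = 0) \<Longrightarrow> tail_small X"
  unfolding tail_small_def by (auto intro!: exI[of _ m])

lemma tail_small_add:
  assumes "tail_small X" "tail_small Y"
  shows "tail_small (\<lambda>i. X i + Y i)"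
  unfolding tail_small_def
proof (intro allI impI)
  fix e :: real assume "e > 0"
  then have "e / 2 > 0" by simp
  then obtain m k where m: "\<And>i. norm (X i o\<^sub>L coproj_op m) \<le> e / 2" and k: "\<And>i. norm (Y i o\<^sub>L coproj_op k) \<le> e / 2"
    using assms unfolding tail_small_def by meson
  have "norm (X i o\<^sub>L coproj_op (max m k)) \<le> e / 2" "norm (Y i o\<^sub>L coproj_op (max m k)) \<le> e / 2" for i
    by (rule order_trans[OF norm_comp_coproj_antimono m] order_trans[OF norm_comp_coproj_antimono k]; simp)+
  then have "norm ((X i + Y i) o\<^sub>L coproj_op (max m k)) \<le> e" for i
    unfolding op_add_distrib using norm_triangle_mono[of _ "e/2" _ "e/2"] by force
  then show "\<exists>m. \<forall>i. norm ((X i + Y i) o\<^sub>L coproj_op m) \<le> e" by blast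
qed

lemma tail_small_comp_left:
  assumes "tail_small X" "\<And>i. norm (Y i) \<le> b"
  shows "tail_small (\<lambda>i. Y i o\<^sub>L X i)"
  unfolding tail_small_def
proof (intro allI impI)
  fix e :: real assume e: "e > 0"
  have b: "b \<ge> 0" using assms(2) norm_ge_zero order_trans by blast
  \<comment> \<open>The divisor is \<open>b + 1\<close> because \<open>b\<close> may be 0.\<close>
  then have "e / (b + 1) > 0" using e by simp
  then obtain m where m: "\<And>i. norm (X i o\<^sub>L coproj_op m) \<le> e / (b + 1)"
    using assms unfolding tail_small_def by meson
  have "norm ((Y i o\<^sub>L X i) o\<^sub>L coproj_op m) \<le> b * (e / (b + 1))" for i
    unfolding op_assoc by (rule norm_comp_le[OF assms(2) m])
  moreover have "b * (e / (b + 1)) \<le> e" using b e by (simp add: field_simps)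
  ultimately show "\<exists>m. \<forall>i. norm (Y i o\<^sub>L X i o\<^sub>L coproj_op m) \<le> e"
    by (meson order_trans)
qed

text \<open>A right factor may move tail vectors back to low indices, where \<open>X i\<close> need
  not be small. The condition on the first \<open>p\<close> rows of \<open>Y i\<close> excludes this
  uniformly in \<open>i\<close>.\<close>

lemma tail_small_comp_right:
  assumes X: "tail_small X" "\<And>i. norm (X i) \<le> b" and Y: "\<And>p. tail_small (\<lambda>i. proj_op p o\<^sub>L Y i)"
    and bd: "\<And>i. norm (Y i) \<le> c"
  shows "tail_small (\<lambda>i. X i o\<^sub>L Y i)"
  unfolding tail_small_def
proof (intro allI impI)
  fix e :: real assume e: "e > 0"
  have b: "b \<ge> 0" "c \<ge> 0" using X(2) bd norm_ge_zero order_trans by blast+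
  then have "e / 2 / (c + 1) > 0" using e by simp
  then obtain p where p: "\<And>i. norm (X i o\<^sub>L coproj_op p) \<le> e / 2 / (c + 1)"
    using X unfolding tail_small_def by meson
  have "e / 2 / (b + 1) > 0" using e b by simp
  then obtain m where m: "\<And>i. norm (proj_op p o\<^sub>L Y i o\<^sub>L coproj_op m) \<le> e / 2 / (b + 1)"
    using Y unfolding tail_small_def by meson
  have "norm (X i o\<^sub>L Y i o\<^sub>L coproj_op m) \<le> e" for i
  proof -
    \<comment> \<open>Split the space between the two factors at \<open>p\<close>: above
      \<open>p\<close> the factor \<open>X i\<close> is small, and below \<open>p\<close> the
      truncated \<open>Y i\<close> has a small tail.\<close>
    have "X i o\<^sub>L Y i o\<^sub>L coproj_op m
        = (((X i o\<^sub>L coproj_op p) o\<^sub>L Y i) o\<^sub>L coproj_op m) + (X i o\<^sub>L (proj_op p o\<^sub>L Y i o\<^sub>L coproj_op m))"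
      by (rule blinfun_eqI) (simp add: coproj_op_def blinfun.diff_left blinfun.diff_right blinfun.add_left)
    moreover have "norm (((X i o\<^sub>L coproj_op p) o\<^sub>L Y i) o\<^sub>L coproj_op m) \<le> (e / 2 / (c + 1) * c) * 1"
      by (intro norm_comp_le p bd norm_coproj_le)
    moreover have "norm (X i o\<^sub>L (proj_op p o\<^sub>L Y i o\<^sub>L coproj_op m)) \<le> b * (e / 2 / (b + 1))"
      by (intro norm_comp_le m X)
    moreover have "(e / 2 / (c + 1) * c) * 1 \<le> e / 2" "b * (e / 2 / (b + 1)) \<le> e / 2"
      using e b by (simp_all add: field_simps)
    ultimately show ?thesis
      by (smt (verit) norm_triangle_ineq field_sum_of_halves)
  qed
  then show "\<exists>m. \<forall>i. norm (X i o\<^sub>L Y i o\<^sub>L coproj_op m) \<le> e" by blast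
qed

lemma tail_small_limit:
  assumes "\<And>e. e > 0 \<Longrightarrow> \<exists>Y. tail_small Y \<and> (\<forall>i. norm (X i - Y i) \<le> e)"
  shows "tail_small X"
  unfolding tail_small_def
proof (intro allI impI)
  fix e :: real assume "e > 0"
  then have e2: "e / 2 > 0" by simp
  obtain Y where Y: "tail_small Y" "\<And>i. norm (X i - Y i) \<le> e / 2" using assms[OF e2] by blast
  obtain m where m: "\<And>i. norm (Y i o\<^sub>L coproj_op m) \<le> e / 2"
    using Y(1) e2 unfolding tail_small_def by meson
  have "norm (X i o\<^sub>L coproj_op m) \<le> e" for i
  proof -
    have "norm ((X i - Y i) o\<^sub>L coproj_op m) \<le> e / 2 * 1" by (rule norm_comp_le[OF Y(2) norm_coproj_le])
    moreover have "X i o\<^sub>L coproj_op m = ((X i - Y i) o\<^sub>L coproj_op m) + (Y i o\<^sub>L coproj_op m)"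
      by (simp add: op_diff_distrib)
    ultimately show ?thesis using m[of i]
      by (smt (verit) norm_triangle_ineq field_sum_of_halves)
  qed
  then show "\<exists>m. \<forall>i. norm (X i o\<^sub>L coproj_op m) \<le> e" by blast
qed

section \<open>Adjoints\<close>

lemma adj_adj: "A \<in> L_ell2 \<Longrightarrow> adj (adj A) = A"
  by (rule adj_eqI[OF adj_in_L]) (metis cinner_adj cinner_commute)+

lemma adj_add:
  assumes "A \<in> L_ell2" "B \<in> L_ell2"
  shows "adj (A + B) = adj A + adj B"
  by (rule adj_eqI)
     (simp_all add: assms add_in_L blinfun.add_left cinner_add_left cinner_add_right cinner_adj)

lemma adj_diff:
  assumes "A \<in> L_ell2" "B \<in> L_ell2"
  shows "adj (A - B) = adj A - adj B"
  using adj_add[OF minus_in_L[OF assms] assms(2)] by (simp add: algebra_simps)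

lemma cscale_op_in_L: "cscale_op c \<in> L_ell2"
  by (rule L_I) (simp add: cscale_op.rep_eq scaleC_ell2_commute)

lemma adj_cscale_op: "adj (cscale_op c) = cscale_op (cnj c)"
  by (rule adj_eqI[OF cscale_op_in_L])
     (simp add: cscale_op.rep_eq cinner_scaleC_left cinner_scaleC_right)

section \<open>Sequences asymptotically commuting with a family of isometries\<close>

text \<open>
  Strong convergence is expressed by the Cauchy property, which avoids the completeness of \<open>ell2\<close>.
\<close>

definition half_regular :: "(nat \<Rightarrow> ell2 \<Rightarrow>\<^sub>L ell2) \<Rightarrow> opseq \<Rightarrow> bool" where
  "half_regular V C \<longleftrightarrow> (\<forall>n. C n \<in> L_ell2) \<and> (\<exists>b. \<forall>n. norm (C n) \<le> b) \<and>
     tail_small (\<lambda>(n, j). (C (n + j) o\<^sub>L V j) - (V j o\<^sub>L C n)) \<and>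
     (\<forall>p. tail_small (\<lambda>n. proj_op p o\<^sub>L C n)) \<and>
     (\<forall>x. Cauchy (\<lambda>n. blinfun_apply (C n) x))"

text \<open>\<open>half_regular\<close> is one-sided: tails are cut off on the right and convergence
  is strong, and neither passes to adjoints. Imposing it on both sequences makes the class closed
  under adjoints.\<close>

definition regular_seq :: "(nat \<Rightarrow> ell2 \<Rightarrow>\<^sub>L ell2) \<Rightarrow> opseq \<Rightarrow> bool" where
  "regular_seq V C \<longleftrightarrow> half_regular V C \<and> half_regular V (\<lambda>n. adj (C n))"

lemma half_regularI:
  assumes "\<And>n. C n \<in> L_ell2" "\<And>n. norm (C n) \<le> b"
    and "tail_small (\<lambda>(n, j). (C (n + j) o\<^sub>L V j) - (V j o\<^sub>L C n))"
    and "\<And>p. tail_small (\<lambda>n. proj_op p o\<^sub>L C n)" "\<And>x. Cauchy (\<lambda>n. blinfun_apply (C n) x)"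
  shows "half_regular V C"
  unfolding half_regular_def by (intro conjI allI exI[of _ b] assms)

lemma half_regularD:
  assumes "half_regular V C"
  shows "C n \<in> L_ell2" "\<exists>b. \<forall>n. norm (C n) \<le> b"
    and "tail_small (\<lambda>(n, j). (C (n + j) o\<^sub>L V j) - (V j o\<^sub>L C n))"
    and "tail_small (\<lambda>n. proj_op p o\<^sub>L C n)" "Cauchy (\<lambda>n. blinfun_apply (C n) x)"
proof -
  note H = assms[unfolded half_regular_def]
  show "C n \<in> L_ell2" by (rule H[THEN conjunct1, THEN spec])
  show "\<exists>b. \<forall>n. norm (C n) \<le> b" by (rule H[THEN conjunct2, THEN conjunct1])
  show "tail_small (\<lambda>(n, j). (C (n + j) o\<^sub>L V j) - (V j o\<^sub>L C n))"
    by (rule H[THEN conjunct2, THEN conjunct2, THEN conjunct1])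
  show "tail_small (\<lambda>n. proj_op p o\<^sub>L C n)"
    by (rule H[THEN conjunct2, THEN conjunct2, THEN conjunct2, THEN conjunct1, THEN spec])
  show "Cauchy (\<lambda>n. blinfun_apply (C n) x)"
    by (rule H[THEN conjunct2, THEN conjunct2, THEN conjunct2, THEN conjunct2, THEN spec])
qed

section \<open>Closure properties of half-regular sequences\<close>

lemma tail_small_reindex: "tail_small X \<Longrightarrow> tail_small (\<lambda>i. X (f i))"
  unfolding tail_small_def by blast

lemma Cauchy_add_normed:
  fixes X Y :: "nat \<Rightarrow> 'a :: real_normed_vector"
  assumes "Cauchy X" "Cauchy Y"
  shows "Cauchy (\<lambda>n. X n + Y n)"
proof (rule CauchyI)
  fix e :: real assume "e > 0"
  then have e2: "e / 2 > 0" by simp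
  obtain M K where M: "\<And>m n. m \<ge> M \<Longrightarrow> n \<ge> M \<Longrightarrow> norm (X m - X n) < e / 2"
    and K: "\<And>m n. m \<ge> K \<Longrightarrow> n \<ge> K \<Longrightarrow> norm (Y m - Y n) < e / 2"
    using CauchyD[OF assms(1) e2] CauchyD[OF assms(2) e2] by meson
  have "norm (X m + Y m - (X n + Y n)) < e" if "m \<ge> max M K" "n \<ge> max M K" for m n
    using M[of m n] K[of m n] that norm_diff_triangle_ineq[of "X m" "Y m" "X n" "Y n"] by simp
  then show "\<exists>M. \<forall>m\<ge>M. \<forall>n\<ge>M. norm (X m + Y m - (X n + Y n)) < e" by blast
qed

lemma half_regular_add:
  assumes A: "half_regular V A" and B: "half_regular V B"
  shows "half_regular V (\<lambda>n. A n + B n)"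
proof -
  obtain a where a: "\<And>n. norm (A n) \<le> a" using half_regularD(2)[OF A] by blast
  obtain b where b: "\<And>n. norm (B n) \<le> b" using half_regularD(2)[OF B] by blast
  show ?thesis
  proof (rule half_regularI)
    show "A n + B n \<in> L_ell2" for n by (intro add_in_L half_regularD(1)[OF A] half_regularD(1)[OF B])
    show "norm (A n + B n) \<le> a + b" for n by (rule norm_triangle_mono[OF a b])
    have "(\<lambda>(n, j). ((A (n + j) + B (n + j)) o\<^sub>L V j) - (V j o\<^sub>L (A n + B n)))
        = (\<lambda>i. (case i of (n, j) \<Rightarrow> (A (n + j) o\<^sub>L V j) - (V j o\<^sub>L A n))
            + (case i of (n, j) \<Rightarrow> (B (n + j) o\<^sub>L V j) - (V j o\<^sub>L B n)))"
      by (rule ext) (simp add: case_prod_unfold op_add_distrib)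
    then show "tail_small (\<lambda>(n, j). ((A (n + j) + B (n + j)) o\<^sub>L V j) - (V j o\<^sub>L (A n + B n)))"
      using tail_small_add[OF half_regularD(3)[OF A] half_regularD(3)[OF B]] by (simp only:)
    show "tail_small (\<lambda>n. proj_op p o\<^sub>L (A n + B n))" for p
      unfolding op_add_distrib by (rule tail_small_add[OF half_regularD(4)[OF A] half_regularD(4)[OF B]])
    show "Cauchy (\<lambda>n. (A n + B n) x)" for x
      unfolding blinfun.add_left by (rule Cauchy_add_normed[OF half_regularD(5)[OF A] half_regularD(5)[OF B]])
  qed
qed

text \<open>The last difference is written \<open>d - c\<close> so that a single estimate, taken at
  two indices, bounds both outer terms.\<close>

lemma norm_diff_le3:
  fixes a b c d :: "'a :: real_normed_vector"
  shows "norm (a - d) \<le> norm (a - b) + norm (b - c) + norm (d - c)"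
  using norm_triangle_ineq4[of "a - b + (b - c)" "d - c"] norm_triangle_ineq[of "a - b" "b - c"]
  by simp

text \<open>Freeze the inner vector at \<open>B M x\<close>: there the Cauchy property of
  \<open>A\<close> applies, and the bound on \<open>A\<close> controls the error of
  freezing.\<close>

lemma strong_Cauchy_comp:
  fixes A B :: opseq
  assumes A: "\<And>x. Cauchy (\<lambda>n. A n x)" "\<And>n. norm (A n) \<le> a" and B: "\<And>x. Cauchy (\<lambda>n. B n x)"
  shows "Cauchy (\<lambda>n. A n (B n x))"
proof (rule CauchyI)
  fix e :: real assume e: "e > 0"
  have a: "a \<ge> 0" using A(2) norm_ge_zero order_trans by blast
  then have "e / 4 / (a + 1) > 0" using e by simp
  then obtain M where M: "\<And>m n. m \<ge> M \<Longrightarrow> n \<ge> M \<Longrightarrow> norm (B m x - B n x) < e / 4 / (a + 1)"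
    using CauchyD[OF B] by blast
  have "e / 2 > 0" using e by simp
  then obtain K where K: "\<And>m n. m \<ge> K \<Longrightarrow> n \<ge> K \<Longrightarrow> norm (A m (B M x) - A n (B M x)) < e / 2"
    using CauchyD[OF A(1)] by blast
  have near: "norm (A m (B m x) - A m (B M x)) \<le> e / 4" if "m \<ge> M" for m
  proof -
    have "norm (A m (B m x - B M x)) \<le> norm (A m) * norm (B m x - B M x)" by (rule norm_blinfun)
    also have "\<dots> \<le> a * (e / 4 / (a + 1))"
      using A(2) M[OF that order_refl] a by (intro mult_mono) auto
    also have "\<dots> \<le> e / 4" using a e by (simp add: field_simps)
    finally show ?thesis by (simp add: blinfun.diff_right)
  qed
  have "norm (A m (B m x) - A n (B n x)) < e" if "m \<ge> max M K" "n \<ge> max M K" for m n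
  proof -
    have "norm (A m (B m x) - A n (B n x)) \<le> norm (A m (B m x) - A m (B M x))
        + norm (A m (B M x) - A n (B M x)) + norm (A n (B n x) - A n (B M x))"
      by (rule norm_diff_le3)
    with near[of m] near[of n] K[of m n] that show ?thesis by simp
  qed
  then show "\<exists>M. \<forall>m\<ge>M. \<forall>n\<ge>M. norm (A m (B m x) - A n (B n x)) < e" by blast
qed

text \<open>The defect D(C) = \<open>C (n + j) V j - V j C n\<close> obeys a Leibniz rule, D(AB) =
  \<open>A (n + j)\<close> D(B) + D(A) \<open>B n\<close>. In the second summand \<open>B n\<close>
  stands on the right, which is what the clause on \<open>proj_op p\<close> in
  \<open>half_regular\<close> is for.\<close>

lemma half_regular_comp:
  assumes V: "\<And>j. norm (V j) \<le> 1" and A: "half_regular V A" and B: "half_regular V B"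
  shows "half_regular V (\<lambda>n. A n o\<^sub>L B n)"
proof -
  obtain a where a: "\<And>n. norm (A n) \<le> a" using half_regularD(2)[OF A] by blast
  obtain b where b: "\<And>n. norm (B n) \<le> b" using half_regularD(2)[OF B] by blast
  let ?D = "\<lambda>C (n, j). (C (n + j) o\<^sub>L V j) - (V j o\<^sub>L C n)"
  show ?thesis
  proof (rule half_regularI)
    show "A n o\<^sub>L B n \<in> L_ell2" for n by (intro comp_in_L half_regularD(1)[OF A] half_regularD(1)[OF B])
    show "norm (A n o\<^sub>L B n) \<le> a * b" for n by (rule norm_comp_le[OF a b])
    have "norm (?D A i) \<le> a * 1 + 1 * a" for i
      unfolding case_prod_unfold
      by (intro order_trans[OF norm_triangle_ineq4] add_mono norm_comp_le a V)
    moreover have "tail_small (\<lambda>i. proj_op p o\<^sub>L B (fst i))" for p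
      by (rule tail_small_reindex[OF half_regularD(4)[OF B]])
    ultimately have 1: "tail_small (\<lambda>i. ?D A i o\<^sub>L B (fst i))"
      by (rule tail_small_comp_right[OF half_regularD(3)[OF A] _ _ b])
    have 2: "tail_small (\<lambda>i. A (fst i + snd i) o\<^sub>L ?D B i)"
      by (rule tail_small_comp_left[OF half_regularD(3)[OF B] a])
    have "(\<lambda>i. (A (fst i + snd i) o\<^sub>L ?D B i) + (?D A i o\<^sub>L B (fst i))) = ?D (\<lambda>n. A n o\<^sub>L B n)"
      by (rule ext) (simp add: case_prod_unfold op_diff_distrib op_assoc)
    then show "tail_small (?D (\<lambda>n. A n o\<^sub>L B n))"
      using tail_small_add[OF 2 1] by (simp only:)
    show "tail_small (\<lambda>n. proj_op p o\<^sub>L (A n o\<^sub>L B n))" for p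
      unfolding op_assoc[symmetric]
      by (rule tail_small_comp_right[OF half_regularD(4)[OF A] norm_comp_le[OF norm_proj_le a]
            half_regularD(4)[OF B] b])
    show "Cauchy (\<lambda>n. (A n o\<^sub>L B n) x)" for x
      unfolding blinfun_apply_blinfun_compose
      by (rule strong_Cauchy_comp[OF half_regularD(5)[OF A] a half_regularD(5)[OF B]])
  qed
qed

lemma Cauchy_limit:
  fixes f :: "nat \<Rightarrow> 'a :: real_normed_vector"
  assumes "\<And>e. e > 0 \<Longrightarrow> \<exists>g. Cauchy g \<and> (\<forall>n. norm (f n - g n) \<le> e)"
  shows "Cauchy f"
proof (rule CauchyI)
  fix e :: real assume "e > 0"
  then have e: "e / 4 > 0" "e / 2 > 0" by simp_all
  obtain g where g: "Cauchy g" "\<And>n. norm (f n - g n) \<le> e / 4" using assms[OF e(1)] by blast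
  obtain M where M: "\<And>m n. m \<ge> M \<Longrightarrow> n \<ge> M \<Longrightarrow> norm (g m - g n) < e / 2"
    using CauchyD[OF g(1) e(2)] by blast
  have "norm (f m - f n) < e" if "m \<ge> M" "n \<ge> M" for m n
  proof -
    have "norm (f m - f n) \<le> norm (f m - g m) + norm (g m - g n) + norm (f n - g n)"
      by (rule norm_diff_le3)
    with g(2)[of m] g(2)[of n] M[OF that] show ?thesis by simp
  qed
  then show "\<exists>M. \<forall>m\<ge>M. \<forall>n\<ge>M. norm (f m - f n) < e" by blast
qed

text \<open>Each clause survives uniform approximation. The defect involves the sequence twice, next
  to contractions \<open>V j\<close>, hence approximation up to \<open>e / 2\<close> there.\<close>

lemma half_regular_limit:
  assumes V: "\<And>j. norm (V j) \<le> 1" and L: "\<And>n. A n \<in> L_ell2"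
    and lim: "\<And>e. e > 0 \<Longrightarrow> \<exists>X. half_regular V X \<and> (\<forall>n. norm (A n - X n) \<le> e)"
  shows "half_regular V A"
proof -
  obtain X where X: "half_regular V X" "\<And>n. norm (A n - X n) \<le> 1"
    using lim[OF zero_less_one] by blast
  obtain b where b: "\<And>n. norm (X n) \<le> b" using half_regularD(2)[OF X(1)] by blast
  show ?thesis
  proof (rule half_regularI[OF L])
    show "norm (A n) \<le> 1 + b" for n
      using norm_triangle_mono[OF X(2) b, of n n] by simp
    show "tail_small (\<lambda>(n, j). (A (n + j) o\<^sub>L V j) - (V j o\<^sub>L A n))" (is "tail_small (?D A)")
    proof (rule tail_small_limit)
      fix e :: real assume "e > 0"
      then have "e / 2 > 0" by simp
      then obtain X where X: "half_regular V X" "\<And>n. norm (A n - X n) \<le> e / 2" using lim by blast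
      let ?DX = "\<lambda>(n, j). (X (n + j) o\<^sub>L V j) - (V j o\<^sub>L X n)"
      have "norm (?D A i - ?DX i) \<le> e" for i
      proof -
        have "?D A i - ?DX i = ((A (fst i + snd i) - X (fst i + snd i)) o\<^sub>L V (snd i))
            - (V (snd i) o\<^sub>L (A (fst i) - X (fst i)))"
          by (simp add: case_prod_unfold op_diff_distrib)
        also have "norm \<dots> \<le> e / 2 * 1 + 1 * (e / 2)"
          by (intro order_trans[OF norm_triangle_ineq4] add_mono norm_comp_le X V)
        finally show ?thesis by simp
      qed
      then show "\<exists>Y. tail_small Y \<and> (\<forall>i. norm (?D A i - Y i) \<le> e)"
        using half_regularD(3)[OF X(1)] by (intro exI[of _ ?DX] conjI allI)
    qed
    show "tail_small (\<lambda>n. proj_op p o\<^sub>L A n)" for p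
    proof (rule tail_small_limit)
      fix e :: real assume "e > 0"
      then obtain X where X: "half_regular V X" "\<And>n. norm (A n - X n) \<le> e" using lim by blast
      have "norm ((proj_op p o\<^sub>L A n) - (proj_op p o\<^sub>L X n)) \<le> e" for n
        using norm_comp_le[OF norm_proj_le X(2)] by (simp add: op_diff_distrib)
      then show "\<exists>Y. tail_small Y \<and> (\<forall>n. norm ((proj_op p o\<^sub>L A n) - Y n) \<le> e)"
        using half_regularD(4)[OF X(1)] by (intro exI[of _ "\<lambda>n. proj_op p o\<^sub>L X n"] conjI allI)
    qed
    show "Cauchy (\<lambda>n. A n x)" for x
    proof (rule Cauchy_limit)
      fix e :: real assume e: "e > 0"
      \<comment> \<open>\<open>norm x + 1\<close> keeps the divisor positive when \<open>x\<close>
        is 0.\<close>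
      then have "e / (norm x + 1) > 0" by (simp add: add_nonneg_pos)
      then obtain X where X: "half_regular V X" "\<And>n. norm (A n - X n) \<le> e / (norm x + 1)"
        using lim by blast
      have "norm (A n x - X n x) \<le> e" for n
      proof -
        have "norm ((A n - X n) x) \<le> norm (A n - X n) * norm x" by (rule norm_blinfun)
        also have "\<dots> \<le> e / (norm x + 1) * norm x" by (intro mult_right_mono X) simp
        also have "\<dots> \<le> e"
        proof -
          have "e * norm x \<le> e * (norm x + 1)" using e by (intro mult_left_mono) auto
          moreover have "norm x + 1 > 0" by (simp add: add_nonneg_pos)
          ultimately show ?thesis by (simp add: pos_divide_le_eq)
        qed
        finally show ?thesis by (simp add: blinfun.diff_left)
      qed
      then show "\<exists>g. Cauchy g \<and> (\<forall>n. norm (A n x - g n) \<le> e)"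
        using half_regularD(5)[OF X(1)] by (intro exI[of _ "\<lambda>n. X n x"] conjI allI)
    qed
  qed
qed

text \<open>Both tail clauses hold with exact zeros: the defect vanishes from index \<open>k\<close>
  on, with the same \<open>k\<close> for all \<open>j\<close>, and the first \<open>p\<close> rows
  of \<open>A\<close> have only finitely many nonzero columns.\<close>

lemma half_regular_constI:
  assumes V: "\<And>j. V j \<in> L_ell2" and A: "A \<in> L_ell2"
    and comm: "\<And>j r. k \<le> r \<Longrightarrow> A (V j (basis_ell2 r)) = V j (A (basis_ell2 r))"
    and tail: "\<And>p. \<exists>m. \<forall>r\<ge>m. proj_op p (A (basis_ell2 r)) = 0"
  shows "half_regular V (\<lambda>_. A)"
proof (rule half_regularI[OF A order_refl])
  show "tail_small (\<lambda>(n :: nat, j). (A o\<^sub>L V j) - (V j o\<^sub>L A))"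
    unfolding case_prod_unfold
    by (rule tail_small_zeroI[where m = k], rule comp_coproj_eq_zeroI)
       (simp_all add: minus_in_L comp_in_L A V blinfun.diff_left comm)
  show "tail_small (\<lambda>n :: nat. proj_op p o\<^sub>L A)" for p
  proof -
    obtain m where "\<And>r. m \<le> r \<Longrightarrow> proj_op p (A (basis_ell2 r)) = 0" using tail by blast
    then show ?thesis
      by (intro tail_small_zeroI[where m = m] comp_coproj_eq_zeroI) (simp_all add: comp_in_L A proj_op_in_L)
  qed
  show "Cauchy (\<lambda>n. A x)" for x by (rule LIMSEQ_imp_Cauchy[OF tendsto_const])
qed

section \<open>Closure properties of regular sequences\<close>

lemma regular_in_L: "regular_seq V A \<Longrightarrow> A n \<in> L_ell2"
  unfolding regular_seq_def using half_regularD(1) by blast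

lemma regular_add:
  assumes "regular_seq V A" "regular_seq V B"
  shows "regular_seq V (\<lambda>n. A n + B n)"
proof -
  have "(\<lambda>n. adj (A n + B n)) = (\<lambda>n. adj (A n) + adj (B n))"
    by (rule ext) (rule adj_add[OF assms[THEN regular_in_L]])
  then show ?thesis
    using assms half_regular_add[of V A B] half_regular_add[of V "\<lambda>n. adj (A n)" "\<lambda>n. adj (B n)"]
    by (simp only: regular_seq_def simp_thms)
qed

lemma regular_comp:
  assumes V: "\<And>j. norm (V j) \<le> 1" and "regular_seq V A" "regular_seq V B"
  shows "regular_seq V (\<lambda>n. A n o\<^sub>L B n)"
proof -
  have "(\<lambda>n. adj (A n o\<^sub>L B n)) = (\<lambda>n. adj (B n) o\<^sub>L adj (A n))"
    by (rule ext) (rule adj_comp[OF assms(2,3)[THEN regular_in_L]])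
  then show ?thesis
    using assms(2,3) half_regular_comp[of V A B, OF V]
      half_regular_comp[of V "\<lambda>n. adj (B n)" "\<lambda>n. adj (A n)", OF V]
    by (simp only: regular_seq_def simp_thms)
qed

lemma regular_adj:
  assumes "regular_seq V A"
  shows "regular_seq V (\<lambda>n. adj (A n))"
proof -
  have "(\<lambda>n. adj (adj (A n))) = A"
    by (rule ext) (rule adj_adj[OF regular_in_L[OF assms]])
  then show ?thesis using assms by (simp only: regular_seq_def simp_thms)
qed

text \<open>Reduces scalar multiples to products with a constant sequence.\<close>

lemma regular_cscale_op:
  assumes "\<And>j. V j \<in> L_ell2"
  shows "regular_seq V (\<lambda>_. cscale_op c)"
proof -
  \<comment> \<open>Needed for all scalars at once, since the adjoint replaces \<open>c\<close> by
    \<open>cnj c\<close>.\<close>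
  have "half_regular V (\<lambda>_. cscale_op c)" for c
  proof (rule half_regular_constI[where k = 0])
    have zero: "scaleC_ell2 c 0 = 0" by transfer simp
    show "\<exists>m. \<forall>r\<ge>m. proj_op p (cscale_op c (basis_ell2 r)) = 0" for p
      by (rule exI[of _ p]) (simp add: cscale_op.rep_eq L_D[OF proj_op_in_L] proj_op_basis zero)
  qed (simp_all add: assms cscale_op_in_L cscale_op.rep_eq L_D)
  then show ?thesis by (simp add: regular_seq_def adj_cscale_op)
qed

lemma regular_scaleC:
  assumes "\<And>j. V j \<in> L_ell2" "\<And>j. norm (V j) \<le> 1" "regular_seq V A"
  shows "regular_seq V (\<lambda>n. scaleC_op c (A n))"
  unfolding scaleC_op_def by (intro regular_comp regular_cscale_op assms)

lemma regular_limit: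
  assumes V: "\<And>j. norm (V j) \<le> 1" and L: "\<And>n. A n \<in> L_ell2"
    and lim: "\<And>e. e > 0 \<Longrightarrow> \<exists>X. regular_seq V X \<and> (\<forall>n. norm (A n - X n) \<le> e)"
  shows "regular_seq V A"
proof -
  have "half_regular V A"
  proof (rule half_regular_limit[OF V L])
    show "\<exists>X. half_regular V X \<and> (\<forall>n. norm (A n - X n) \<le> e)" if "e > 0" for e
      using lim[OF that] unfolding regular_seq_def by blast
  qed
  moreover have "half_regular V (\<lambda>n. adj (A n))"
  proof (rule half_regular_limit[OF V adj_in_L[OF L]])
    fix e :: real assume "e > 0"
    then obtain X where X: "regular_seq V X" "\<And>n. norm (A n - X n) \<le> e" using lim by blast
    \<comment> \<open>Adjoints do not increase norms, so the adjoints of the same approximants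
      serve.\<close>
    have "norm (adj (A n) - adj (X n)) \<le> e" for n
      unfolding adj_diff[OF L regular_in_L[OF X(1)], symmetric]
      by (rule order_trans[OF norm_adj_le[OF minus_in_L[OF L regular_in_L[OF X(1)]]] X(2)])
    with X(1) show "\<exists>X. half_regular V X \<and> (\<forall>n. norm (adj (A n) - X n) \<le> e)"
      unfolding regular_seq_def by (intro exI[of _ "\<lambda>n. adj (X n)"] conjI allI) simp_all
  qed
  ultimately show ?thesis by (simp only: regular_seq_def simp_thms)
qed

lemma regular_zero:
  assumes "\<And>j. V j \<in> L_ell2"
  shows "regular_seq V (\<lambda>_. 0)"
proof -
  have "adj 0 = 0"
    using adj_diff[OF zero_in_L zero_in_L] by simp
  moreover have "half_regular V (\<lambda>_. 0)"
    by (rule half_regular_constI[where k = 0]) (simp_all add: assms zero_in_L blinfun.zero_right)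
  ultimately show ?thesis by (simp only: regular_seq_def simp_thms)
qed

text \<open>By minimality of \<open>cuntz N\<close>, regularity of its elements needs to be checked
  on the generators alone.\<close>

lemma cstar_subalgebra_L_regular:
  assumes V: "\<And>j. V j \<in> L_ell2" "\<And>j. norm (V j) \<le> 1"
  shows "cstar_subalgebra_L {A. regular_seq V (\<lambda>_. A)}"
  unfolding cstar_subalgebra_L_def
proof (intro conjI ballI allI)
  show L: "{A. regular_seq V (\<lambda>_. A)} \<subseteq> L_ell2"
  proof
    fix B assume "B \<in> {A. regular_seq V (\<lambda>_. A)}"
    then have "regular_seq V (\<lambda>_. B)" by (rule CollectD)
    then show "B \<in> L_ell2" by (rule regular_in_L)
  qed
  show "closed {A. regular_seq V (\<lambda>_. A)}"
    unfolding closure_subset_eq[symmetric]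
  proof (rule subsetI, rule CollectI)
    fix A assume A: "A \<in> closure {A. regular_seq V (\<lambda>_. A)}"
    show "regular_seq V (\<lambda>_. A)"
    proof (rule regular_limit[OF V(2)])
      show "A \<in> L_ell2" by (rule subsetD[OF closure_minimal[OF L closed_L_ell2] A])
      fix e :: real assume "e > 0"
      then obtain B where B: "B \<in> {A. regular_seq V (\<lambda>_. A)}" "dist B A < e"
        using A unfolding closure_approachable by meson
      then have "norm (A - B) \<le> e" by (simp add: dist_norm norm_minus_commute)
      then show "\<exists>X. regular_seq V X \<and> (\<forall>n. norm (A - X n) \<le> e)"
        using CollectD[OF B(1)] by (intro exI[of _ "\<lambda>_. B"] conjI allI)
    qed
  qed
qed (auto intro: regular_add regular_comp regular_scaleC regular_adj regular_zero[OF V(1)] V)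

text \<open>Membership in \<open>F_alg\<close> provides the upper bound that gives the supremum in
  \<open>sup_norm\<close> its meaning.\<close>

lemma norm_le_sup_norm:
  assumes "X \<in> F_alg \<eta>" "A \<in> F_alg \<eta>"
  shows "norm (X n - A n) \<le> sup_norm (\<lambda>n. X n - A n)"
proof -
  obtain a b where "\<And>n. norm (X n) \<le> a" "\<And>n. norm (A n) \<le> b" using F_alg_D(4) assms by metis
  then have "norm (X n - A n) \<le> a + b" for n
    by (meson norm_triangle_ineq4 add_mono order_trans)
  then have "bdd_above (range (\<lambda>n. norm (X n - A n)))" by (intro bdd_aboveI2)
  then show ?thesis unfolding sup_norm_def by (intro cSUP_upper) auto
qed

lemma cstar_subalgebra_F_D:
  assumes "cstar_subalgebra_F \<eta> S"
  shows "S \<subseteq> F_alg \<eta>" "(\<lambda>_. 0) \<in> S"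
    and "A \<in> S \<Longrightarrow> B \<in> S \<Longrightarrow> (\<lambda>n. A n + B n) \<in> S" "A \<in> S \<Longrightarrow> B \<in> S \<Longrightarrow> (\<lambda>n. A n o\<^sub>L B n) \<in> S"
    and "A \<in> S \<Longrightarrow> (\<lambda>n. scaleC_op c (A n)) \<in> S" "A \<in> S \<Longrightarrow> (\<lambda>n. adj (A n)) \<in> S"
proof -
  note H = assms[unfolded cstar_subalgebra_F_def]
  note H2 = H[THEN conjunct2, THEN conjunct2]
  show "S \<subseteq> F_alg \<eta>" by (rule H[THEN conjunct1])
  show "(\<lambda>_. 0) \<in> S" by (rule H[THEN conjunct2, THEN conjunct1])
  show "(\<lambda>n. A n + B n) \<in> S" if "A \<in> S" "B \<in> S"
    by (rule H2[THEN conjunct1, THEN bspec, THEN bspec, OF that, THEN conjunct1])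
  show "(\<lambda>n. A n o\<^sub>L B n) \<in> S" if "A \<in> S" "B \<in> S"
    by (rule H2[THEN conjunct1, THEN bspec, THEN bspec, OF that, THEN conjunct2])
  show "(\<lambda>n. scaleC_op c (A n)) \<in> S" if "A \<in> S"
    by (rule H2[THEN conjunct2, THEN conjunct1, THEN spec, THEN bspec, OF that])
  show "(\<lambda>n. adj (A n)) \<in> S" if "A \<in> S"
    by (rule H2[THEN conjunct2, THEN conjunct2, THEN conjunct1, THEN bspec, OF that])
qed

text \<open>The counterpart for sequences, to be used with the minimality of \<open>S_alg\<close>.
  For closedness, a single approximant close in the supremum norm is a uniform approximant as in
  \<open>regular_limit\<close>.\<close>

lemma cstar_subalgebra_F_regular:
  assumes V: "\<And>j. V j \<in> L_ell2" "\<And>j. norm (V j) \<le> 1"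
  shows "cstar_subalgebra_F \<eta> {A \<in> F_alg \<eta>. regular_seq V A}"
proof -
  have "regular_seq V A"
    if A: "A \<in> F_alg \<eta>" and X: "\<And>k. X k \<in> F_alg \<eta>" "\<And>k. regular_seq V (X k)"
      and lim: "(\<lambda>k. sup_norm (\<lambda>n. X k n - A n)) \<longlonglongrightarrow> 0" for A X
  proof (rule regular_limit[OF V(2) F_alg_D(1)[OF A]])
    fix e :: real assume "e > 0"
    then obtain k where "sup_norm (\<lambda>n. X k n - A n) < e"
      using order_tendstoD(2)[OF lim] by (meson eventually_sequentially order_refl)
    then have "norm (A n - X k n) \<le> e" for n
      using norm_le_sup_norm[OF X(1) A, of k n] by (simp add: norm_minus_commute)
    then show "\<exists>X. regular_seq V X \<and> (\<forall>n. norm (A n - X n) \<le> e)" using X(2) by blast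
  qed
  note closed = this
  note F = cstar_subalgebra_F_D[OF cstar_subalgebra_F_alg[of \<eta>]]
  show ?thesis
    unfolding cstar_subalgebra_F_def
  proof (intro conjI ballI allI impI CollectI)
    show "{A \<in> F_alg \<eta>. regular_seq V A} \<subseteq> F_alg \<eta>" by blast
    show "(\<lambda>_. 0) \<in> F_alg \<eta>" by (rule F(2))
    show "regular_seq V (\<lambda>_. 0)" by (rule regular_zero[OF V(1)])
  next
    fix A B assume "A \<in> {A \<in> F_alg \<eta>. regular_seq V A}" "B \<in> {A \<in> F_alg \<eta>. regular_seq V A}"
    then have A: "A \<in> F_alg \<eta>" "regular_seq V A" and B: "B \<in> F_alg \<eta>" "regular_seq V B" by simp_all
    show "(\<lambda>n. A n + B n) \<in> F_alg \<eta>" "(\<lambda>n. A n o\<^sub>L B n) \<in> F_alg \<eta>"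
      by (rule F(3,4)[OF A(1) B(1)])+
    show "regular_seq V (\<lambda>n. A n + B n)" by (rule regular_add[OF A(2) B(2)])
    show "regular_seq V (\<lambda>n. A n o\<^sub>L B n)" by (rule regular_comp[OF V(2) A(2) B(2)])
  next
    fix A c assume "A \<in> {A \<in> F_alg \<eta>. regular_seq V A}"
    then have A: "A \<in> F_alg \<eta>" "regular_seq V A" by simp_all
    show "(\<lambda>n. scaleC_op c (A n)) \<in> F_alg \<eta>" "(\<lambda>n. adj (A n)) \<in> F_alg \<eta>"
      by (rule F(5,6)[OF A(1)])+
    show "regular_seq V (\<lambda>n. scaleC_op c (A n))" by (rule regular_scaleC[OF V A(2)])
    show "regular_seq V (\<lambda>n. adj (A n))" by (rule regular_adj[OF A(2)])
  next
    fix X A assume A: "A \<in> F_alg \<eta>"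
      and X: "(\<forall>k. X k \<in> {A \<in> F_alg \<eta>. regular_seq V A}) \<and> (\<lambda>k. sup_norm (\<lambda>n. X k n - A n)) \<longlonglongrightarrow> 0"
    show "A \<in> F_alg \<eta>" by (rule A)
    show "regular_seq V A"
    proof (rule closed[OF A])
      show "X k \<in> F_alg \<eta>" "regular_seq V (X k)" for k using X by simp_all
      show "(\<lambda>k. sup_norm (\<lambda>n. X k n - A n)) \<longlonglongrightarrow> 0" using X by (rule conjunct2)
    qed
  qed
qed

section \<open>Fractality criterion\<close>

text \<open>A crude bound by column norms, from \<bar>x_r\<bar> \<le> \<open>norm x\<close>. It
  turns strong convergence into norm convergence on the span of the first \<open>m\<close> basis
  vectors.\<close>

lemma norm_comp_proj_le:
  assumes "A \<in> L_ell2"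
  shows "norm (A o\<^sub>L proj_op m) \<le> (\<Sum>r<m. norm (A (basis_ell2 r)))"
proof (rule norm_blinfun_bound)
  fix x
  have coord: "norm (ell2_nth x r) \<le> norm x" for r
  proof -
    have "(norm (ell2_nth x r))\<^sup>2 \<le> (\<Sum>n<Suc r. (norm (ell2_nth x n))\<^sup>2)"
      by (rule member_le_sum[where f = "\<lambda>n. (norm (ell2_nth x n))\<^sup>2"]) auto
    then have "(norm (ell2_nth x r))\<^sup>2 \<le> (norm x)\<^sup>2" using sum_le_norm_ell2_sq order_trans by blast
    then show ?thesis by simp
  qed
  show "norm ((A o\<^sub>L proj_op m) x) \<le> (\<Sum>r<m. norm (A (basis_ell2 r))) * norm x"
  proof (induction m)
    case 0
    have "proj_ell2 0 x = 0" by transfer simp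
    then show ?case by (simp add: proj_op.rep_eq blinfun.zero_right)
  next
    case (Suc m)
    have "norm (A (scaleC_ell2 (ell2_nth x m) (basis_ell2 m))) \<le> norm x * norm (A (basis_ell2 m))"
      using mult_right_mono[OF coord] by (simp add: L_D assms norm_scaleC)
    from norm_triangle_mono[OF Suc this] show ?case
      by (simp add: proj_op.rep_eq proj_Suc blinfun.add_right algebra_simps)
  qed
qed (simp add: sum_nonneg)

lemma regular_vanishing_subseq:
  fixes \<mu> :: "nat \<Rightarrow> nat"
  assumes C: "regular_seq V C" and V: "\<And>j x. norm (V j x) = norm x"
    and \<mu>: "strict_mono \<mu>" "\<And>k. C (\<mu> k) = 0"
  shows "(\<lambda>n. norm (C n)) \<longlonglongrightarrow> 0"
proof (rule LIMSEQ_I)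
  fix e :: real assume "e > 0"
  then have e2: "e / 2 > 0" by simp
  have half: "half_regular V C" using C unfolding regular_seq_def by blast
  then obtain m where m: "\<And>n j. norm (((C (n + j) o\<^sub>L V j) - (V j o\<^sub>L C n)) o\<^sub>L coproj_op m) \<le> e / 2"
    using half_regularD(3)[OF half] e2 unfolding tail_small_def case_prod_unfold
    by (metis fst_conv snd_conv)
  have upper: "norm (C n o\<^sub>L coproj_op m) \<le> e / 2" for n
  proof -
    \<comment> \<open>A strictly increasing \<open>\<mu>\<close> satisfies n \<le>
      \<open>\<mu> n\<close>, so the shift can land on an index where \<open>C\<close> vanishes;
      only the term \<open>V j\<close> after \<open>C n\<close> of the defect remains.\<close>
    obtain j where j: "\<mu> n = n + j" using seq_suble[OF \<mu>(1), of n] le_Suc_ex by blast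
    have "norm ((V j o\<^sub>L C n) o\<^sub>L coproj_op m) \<le> e / 2"
      using m[of n j] \<mu>(2)[of n] by (simp add: j op_zero op_diff_distrib)
    moreover have "norm (C n o\<^sub>L coproj_op m) \<le> norm ((V j o\<^sub>L C n) o\<^sub>L coproj_op m)"
      by (rule norm_blinfun_bound) (use norm_blinfun[of "(V j o\<^sub>L C n) o\<^sub>L coproj_op m"] V in auto)
    ultimately show ?thesis by simp
  qed
  have "(\<lambda>n. C n x) \<longlonglongrightarrow> 0" for x
  proof (rule LIMSEQ_I)
    fix d :: real assume "d > 0"
    then obtain M where M: "\<And>k n. k \<ge> M \<Longrightarrow> n \<ge> M \<Longrightarrow> norm (C n x - C k x) < d"
      using CauchyD[OF half_regularD(5)[OF half]] by meson
    have "norm (C n x - 0) < d" if "n \<ge> M" for n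
      \<comment> \<open>Compare with the index \<open>\<mu> M\<close>, which is at least
        \<open>M\<close> and gives the zero operator.\<close>
      using M[OF seq_suble[OF \<mu>(1)] that] \<mu>(2)[of M] by simp
    then show "\<exists>M. \<forall>n\<ge>M. norm (C n x - 0) < d" by blast
  qed
  then have "(\<lambda>n. \<Sum>r<m. norm (C n (basis_ell2 r))) \<longlonglongrightarrow> (\<Sum>r<m. 0)"
    by (intro tendsto_sum tendsto_norm_zero)
  then have "eventually (\<lambda>n. (\<Sum>r<m. norm (C n (basis_ell2 r))) < e / 2) sequentially"
    using order_tendstoD(2) e2 by fastforce
  then have "eventually (\<lambda>n. norm (C n) < e) sequentially"
  proof eventually_elim
    case (elim n)
    have "C n = (C n o\<^sub>L proj_op m) + (C n o\<^sub>L coproj_op m)"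
      by (rule blinfun_eqI) (simp add: coproj_op_def blinfun.add_left blinfun.diff_left blinfun.diff_right)
    then have "norm (C n) \<le> norm (C n o\<^sub>L proj_op m) + norm (C n o\<^sub>L coproj_op m)"
      by (metis norm_triangle_ineq)
    then show ?case
      using norm_comp_proj_le[OF regular_in_L[OF C], of n m] upper[of n] elim by simp
  qed
  then show "\<exists>M. \<forall>n\<ge>M. norm (norm (C n) - 0) < e"
    by (simp add: eventually_sequentially)
qed

section \<open>The quotient by null sequences\<close>

lemma cstar_subalgebra_F_diff:
  assumes "cstar_subalgebra_F \<eta> S" "A \<in> S" "B \<in> S"
  shows "(\<lambda>n. A n - B n) \<in> S"
proof -
  have "scaleC_ell2 (-1) x = - x" for x by transfer simp
  then have "scaleC_op (-1) X = - X" for X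
    unfolding scaleC_op_def by (intro blinfun_eqI) (simp add: cscale_op.rep_eq blinfun.minus_left)
  moreover have "(\<lambda>n. A n + scaleC_op (-1) (B n)) \<in> S"
    using assms by (intro cstar_subalgebra_F_D[OF assms(1)])
  ultimately show ?thesis by simp
qed

lemma G_ideal_diff:
  assumes "A \<in> G_ideal \<eta>" "B \<in> G_ideal \<eta>"
  shows "(\<lambda>n. A n - B n) \<in> G_ideal \<eta>"
proof -
  have F: "A \<in> F_alg \<eta>" "B \<in> F_alg \<eta>"
    and lim: "(\<lambda>n. norm (A n)) \<longlonglongrightarrow> 0" "(\<lambda>n. norm (B n)) \<longlonglongrightarrow> 0"
    using assms by (simp_all add: G_ideal_def)
  have "(\<lambda>n. A n - B n) \<longlonglongrightarrow> 0 - 0"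
    by (rule tendsto_diff[OF tendsto_norm_zero_cancel tendsto_norm_zero_cancel, OF lim])
  then have "(\<lambda>n. norm (A n - B n)) \<longlonglongrightarrow> 0"
    by (intro tendsto_norm_zero) simp
  then show ?thesis
    using cstar_subalgebra_F_diff[OF cstar_subalgebra_F_alg F] by (simp add: G_ideal_def)
qed

text \<open>The null sequences in \<open>S\<close> contain 0 and are closed under differences, hence
  form an additive group; symmetry uses 0 - (A - B), transitivity (A - B) - (C - B).\<close>

lemma equiv_quot_rel:
  assumes S: "cstar_subalgebra_F \<eta> S"
  shows "equiv S (quot_rel \<eta> S)"
proof (rule equivI)
  have diff: "(\<lambda>n. A n - B n) \<in> S \<inter> G_ideal \<eta>" if "A \<in> S \<inter> G_ideal \<eta>" "B \<in> S \<inter> G_ideal \<eta>" for A B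
    using that cstar_subalgebra_F_diff[OF S] G_ideal_diff by blast
  have zero: "(\<lambda>_. 0) \<in> S \<inter> G_ideal \<eta>"
    using cstar_subalgebra_F_D(2)[OF S] cstar_subalgebra_F_D(2)[OF cstar_subalgebra_F_alg]
    by (simp add: G_ideal_def)
  show "quot_rel \<eta> S \<subseteq> S \<times> S" by (auto simp: quot_rel_def)
  show "refl_on S (quot_rel \<eta> S)"
    using zero by (auto simp: refl_on_def quot_rel_def)
  show "sym (quot_rel \<eta> S)"
    using diff[OF zero] by (force simp: sym_def quot_rel_def)
  have neg: "(\<lambda>n. B n - A n) \<in> S \<inter> G_ideal \<eta>" if "(\<lambda>n. A n - B n) \<in> S \<inter> G_ideal \<eta>" for A B :: opseq
    using diff[OF zero that] by simp
  show "trans (quot_rel \<eta> S)"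
  proof (rule transI)
    fix A B C assume AB: "(A, B) \<in> quot_rel \<eta> S" and BC: "(B, C) \<in> quot_rel \<eta> S"
    then have "(\<lambda>n. A n - B n) \<in> S \<inter> G_ideal \<eta>" "(\<lambda>n. B n - C n) \<in> S \<inter> G_ideal \<eta>"
      by (simp_all add: quot_rel_def)
    from diff[OF this(1) neg[OF this(2)]] show "(A, C) \<in> quot_rel \<eta> S"
      using AB BC by (simp add: quot_rel_def)
  qed
qed

text \<open>The value of \<open>W'\<close> at a restricted sequence is the class of any preimage.
  Two preimages differ by a sequence vanishing exactly along \<open>\<mu>\<close>, which
  \<open>vanish\<close> makes null, so the choice does not matter.\<close>

lemma fractalI:
  assumes S: "cstar_subalgebra_F \<eta> S"
    and vanish: "\<And>C (\<mu> :: nat \<Rightarrow> nat). C \<in> S \<Longrightarrow> strict_mono \<mu> \<Longrightarrow> (\<And>k. C (\<mu> k) = 0) \<Longrightarrow> (\<lambda>n. norm (C n)) \<longlonglongrightarrow> 0"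
  shows "fractal \<eta> S"
  unfolding fractal_def fractal_hom_def
proof (intro conjI allI impI S)
  fix \<mu> :: "nat \<Rightarrow> nat" assume \<mu>: "strict_mono \<mu>"
  define lift where "lift = inv_into S (restrict_seq \<mu>)"
  have lift: "lift (restrict_seq \<mu> A) \<in> S"
      "restrict_seq \<mu> (lift (restrict_seq \<mu> A)) = restrict_seq \<mu> A" if "A \<in> S" for A
    using inv_into_into[of "restrict_seq \<mu> A" "restrict_seq \<mu>" S]
      f_inv_into_f[of "restrict_seq \<mu> A" "restrict_seq \<mu>" S] that by (auto simp: lift_def)
  have "quot_rel \<eta> S `` {A} = quot_rel \<eta> S `` {lift (restrict_seq \<mu> A)}" if A: "A \<in> S" for A
  proof (rule equiv_class_eq[OF equiv_quot_rel[OF S]])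
    let ?C = "\<lambda>n. A n - lift (restrict_seq \<mu> A) n"
    have C: "?C \<in> S" by (rule cstar_subalgebra_F_diff[OF S A lift(1)[OF A]])
    have "?C (\<mu> k) = 0" for k
      using fun_cong[OF lift(2)[OF A], of k] by (simp add: restrict_seq_def)
    then have "(\<lambda>n. norm (?C n)) \<longlonglongrightarrow> 0" by (rule vanish[OF C \<mu>])
    then show "(A, lift (restrict_seq \<mu> A)) \<in> quot_rel \<eta> S"
      using A lift(1)[OF A] C cstar_subalgebra_F_D(1)[OF S]
      by (simp add: quot_rel_def G_ideal_def subset_iff)
  qed
  then show "\<exists>W'\<in>restrict_seq \<mu> ` S \<rightarrow> S // quot_rel \<eta> S.
      \<forall>A\<in>S. quot_rel \<eta> S `` {A} = W' (restrict_seq \<mu> A)"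
    by (intro bexI[of _ "\<lambda>B. quot_rel \<eta> S `` {lift B}"]) (auto intro: quotientI lift(1))
qed

section \<open>Inserting a leading digit\<close>

text \<open>The case \<open>N < 2\<close> of the definition only serves termination.\<close>

fun insert_digit :: "nat \<Rightarrow> nat \<Rightarrow> nat" where
  "insert_digit N r = (if r = 0 \<or> N < 2 then 1 else N * insert_digit N (r div N) + r mod N)"

declare insert_digit.simps [simp del]

lemma insert_digit_0: "insert_digit N 0 = 1"
  by (simp add: insert_digit.simps)

lemma insert_digit_pos: "insert_digit N r > 0"
  by (induction N r rule: insert_digit.induct) (subst insert_digit.simps, auto)

context
  fixes N :: nat
  assumes N: "N \<ge> 2"
begin

lemma insert_digit_rec:
  assumes "r > 0"
  shows "insert_digit N r = N * insert_digit N (r div N) + r mod N"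
  using assms N by (subst insert_digit.simps) auto

text \<open>Digits at opposite ends do not interfere. The number 0 is exceptional, having an empty
  expansion: for \<open>q = 0\<close> and \<open>i = 0\<close> the two sides would be 1 and
  \<open>N\<close>.\<close>

lemma insert_digit_append:
  assumes "q > 0" "i < N"
  shows "insert_digit N (q * N + i) = insert_digit N q * N + i"
  using insert_digit_rec[of "q * N + i"] assms by simp

lemma insert_digit_ge:
  assumes "r > 0"
  shows "insert_digit N r \<ge> N"
proof -
  have "N * 1 \<le> N * insert_digit N (r div N)"
    using insert_digit_pos[of N "r div N"] by (intro mult_le_mono2) simp
  then show ?thesis unfolding insert_digit_rec[OF assms] by linarith
qed

text \<open>Compare the numbers without their last digits by induction; if these agree, the last
  digits decide. Monotonicity makes the reindexing below an isometry.\<close>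

lemma insert_digit_less:
  "r < s \<Longrightarrow> insert_digit N r < insert_digit N s"
proof (induction s arbitrary: r rule: less_induct)
  case (less s)
  show ?case
  proof (cases "r = 0")
    case True
    then show ?thesis using less.prems insert_digit_ge[of s] N by (simp add: insert_digit_0)
  next
    case False
    note rec = insert_digit_rec[of r] insert_digit_rec[of s]
    have le: "r div N \<le> s div N" using less.prems by (intro div_le_mono) simp
    show ?thesis
    proof (cases "r div N = s div N")
      case True
      then have "r mod N < s mod N"
        using less.prems by (metis div_mult_mod_eq nat_add_left_cancel_less)
      then show ?thesis using False less.prems rec True by simp
    next
      case neq: False
      then have "insert_digit N (r div N) + 1 \<le> insert_digit N (s div N)"
        using less.IH[of "s div N" "r div N"] le less.prems N by (simp add: Suc_le_eq)
      then have "N * (insert_digit N (r div N) + 1) \<le> N * insert_digit N (s div N)"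
        by (rule mult_le_mono2)
      moreover have "r mod N < N" using N by simp
      ultimately have "N * insert_digit N (r div N) + r mod N < N * insert_digit N (s div N)"
        by (simp add: algebra_simps)
      then show ?thesis using False less.prems rec by simp
    qed
  qed
qed

text \<open>The expansion becomes longer by exactly one digit. Hence the isometry carries the
  projection of rank \<open>N ^ n\<close> to that of rank \<open>N ^ Suc n\<close>. At
  \<open>n = 0\<close>, only 0 is mapped below \<open>N\<close>.\<close>

lemma insert_digit_less_power: "insert_digit N r < N ^ Suc n \<longleftrightarrow> r < N ^ n"
proof (induction n arbitrary: r)
  case 0
  show ?case using insert_digit_ge[of r] N by (cases "r = 0") (auto simp: insert_digit_0)
next
  case (Suc n)
  show ?case
  proof (cases "r = 0")
    case True
    have "1 < N ^ Suc (Suc n)" using N by (intro one_less_power) auto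
    then show ?thesis using True N by (simp add: insert_digit_0)
  next
    case False
    \<comment> \<open>Division by \<open>N\<close> removes the last digit, which insertion in front
      leaves alone.\<close>
    have lt: "k < N ^ Suc m \<longleftrightarrow> k div N < N ^ m" for k m
      using N by (simp add: div_less_iff_less_mult mult.commute)
    have "insert_digit N r div N = insert_digit N (r div N)"
      unfolding insert_digit_rec[of r, simplified, OF False[simplified]] using N by simp
    then show ?thesis using Suc[of "r div N"] by (simp only: lt)
  qed
qed

lemma strict_mono_insert_digits: "strict_mono (insert_digit N ^^ j)"
  by (induction j) (auto simp: strict_mono_def insert_digit_less)

text \<open>Positivity is proved along with the equation, since the induction step appends a digit
  to the iterate at \<open>q\<close>, which must be nonzero.\<close>

lemma insert_digits_append:
  assumes "q > 0" "i < N"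
  shows "(insert_digit N ^^ j) (q * N + i) = (insert_digit N ^^ j) q * N + i"
    and "(insert_digit N ^^ j) q > 0"
proof (induction j)
  case (Suc j)
  { case 1
    show ?case using Suc insert_digit_append[OF Suc(2) assms(2)] by simp }
  { case 2
    show ?case using insert_digit_pos by simp }
qed (use assms in simp_all)

lemma insert_digits_less_power: "(insert_digit N ^^ j) r < N ^ (n + j) \<longleftrightarrow> r < N ^ n"
  by (induction j) (simp_all only: funpow.simps o_apply id_apply add_0_right add_Suc_right insert_digit_less_power)

end

text \<open>Sends the basis vector at \<open>r\<close> to the one at \<open>f r\<close>. The default
  0 for other \<open>f\<close> keeps the result square-summable for every \<open>f\<close>.\<close>

lift_definition reindex_ell2 :: "(nat \<Rightarrow> nat) \<Rightarrow> ell2 \<Rightarrow> ell2" is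
  "\<lambda>f x k. if strict_mono f \<and> k \<in> range f then x (inv f k) else 0"
  subgoal for f x
    using summable_mono_reindex[of f "\<lambda>k. (norm (if strict_mono f \<and> k \<in> range f then x (inv f k) else 0))\<^sup>2"]
    by (cases "strict_mono f") (auto simp: strict_mono_imp_inj_on inv_f_f)
  done

text \<open>Off the range of \<open>f\<close> the entries are 0, so the sum of squares only runs
  over the old entries.\<close>

lemma norm_reindex_ell2:
  assumes "strict_mono f"
  shows "norm (reindex_ell2 f x) = norm x"
proof -
  have "(norm (reindex_ell2 f x))\<^sup>2 = (norm x)\<^sup>2"
    unfolding norm_ell2_sq
    by (subst suminf_mono_reindex[OF assms, symmetric])
       (use assms in \<open>auto simp: reindex_ell2.rep_eq inv_f_f strict_mono_imp_inj_on\<close>)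
  then show ?thesis by (simp add: power2_eq_iff_nonneg)
qed

lift_definition reindex_op :: "(nat \<Rightarrow> nat) \<Rightarrow> ell2 \<Rightarrow>\<^sub>L ell2" is reindex_ell2
proof (rule bounded_linear_intro[where K = 1])
  fix f x
  show "norm (reindex_ell2 f x) \<le> norm x * 1"
  proof (cases "strict_mono f")
    case False
    then have "reindex_ell2 f x = 0" by (intro ell2_eqI) (simp add: reindex_ell2.rep_eq zero_ell2.rep_eq)
    then show ?thesis by simp
  qed (simp add: norm_reindex_ell2)
qed (rule ell2_eqI, simp add: reindex_ell2.rep_eq plus_ell2.rep_eq scaleR_ell2.rep_eq)+

lemma reindex_op_in_L: "reindex_op f \<in> L_ell2"
  by (rule L_I, rule ell2_eqI) (simp add: reindex_op.rep_eq reindex_ell2.rep_eq scaleC_ell2.rep_eq)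

lemma norm_reindex_op: "strict_mono f \<Longrightarrow> norm (reindex_op f x) = norm x"
  by (simp add: reindex_op.rep_eq norm_reindex_ell2)

lemma reindex_op_basis:
  assumes "strict_mono f"
  shows "reindex_op f (basis_ell2 r) = basis_ell2 (f r)"
proof (rule ell2_eqI)
  fix k
  have "inj f" using assms by (rule strict_mono_imp_inj_on)
  then show "ell2_nth (reindex_op f (basis_ell2 r)) k = ell2_nth (basis_ell2 (f r)) k"
    using assms by (auto simp: reindex_op.rep_eq reindex_ell2.rep_eq basis_nth inv_f_f)
qed

section \<open>The digit isometries and regularity of the finite sections\<close>

context
  fixes N :: nat
  assumes N: "N \<ge> 2"
begin

text \<open>The power \<open>V^j\<close>, taken directly as reindexing along the iterate rather than
  as an iterated product of operators.\<close>

definition digit_op :: "nat \<Rightarrow> ell2 \<Rightarrow>\<^sub>L ell2" where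
  "digit_op j = reindex_op (insert_digit N ^^ j)"

lemma digit_op_in_L: "digit_op j \<in> L_ell2"
  by (simp add: digit_op_def reindex_op_in_L)

lemma norm_digit_op_apply: "norm (digit_op j x) = norm x"
  by (simp add: digit_op_def norm_reindex_op strict_mono_insert_digits N)

lemma norm_digit_op_le: "norm (digit_op j) \<le> 1"
  by (rule norm_blinfun_bound) (simp_all add: norm_digit_op_apply)

lemma digit_op_basis: "digit_op j (basis_ell2 r) = basis_ell2 ((insert_digit N ^^ j) r)"
  by (simp add: digit_op_def reindex_op_basis strict_mono_insert_digits N)

lemma regular_S_op:
  assumes i: "i < N"
  shows "regular_seq digit_op (\<lambda>_. S_op N i)"
  unfolding regular_seq_def
proof
  show "half_regular digit_op (\<lambda>_. S_op N i)"
  \<comment> \<open>Only \<open>r = 0\<close> is excluded, the exception in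
    \<open>insert_digits_append\<close>.\<close>
  proof (rule half_regular_constI[where k = 1])
    show "\<exists>m. \<forall>r\<ge>m. proj_op p (S_op N i (basis_ell2 r)) = 0" for p
    proof (intro exI[of _ p] allI impI)
      fix r assume "p \<le> r"
      also have "r \<le> r * N + i" using N by (simp add: trans_le_add1)
      finally show "proj_op p (S_op N i (basis_ell2 r)) = 0"
        by (simp add: S_op_basis[OF i] proj_op_basis)
    qed
    show "S_op N i (digit_op j (basis_ell2 r)) = digit_op j (S_op N i (basis_ell2 r))" if "1 \<le> r" for j r
      using that insert_digits_append[OF N _ i] by (simp add: S_op_basis[OF i] digit_op_basis)
  qed (simp_all add: digit_op_in_L S_op_in_L)
  show "half_regular digit_op (\<lambda>_. adj (S_op N i))"
  \<comment> \<open>The adjoint deletes the last digit; from \<open>N\<close> on something nonzero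
    is left.\<close>
  proof (rule half_regular_constI[where k = N])
    show "\<exists>m. \<forall>r\<ge>m. proj_op p (adj (S_op N i) (basis_ell2 r)) = 0" for p
    \<comment> \<open>The image index is \<open>r div N\<close>, which reaches \<open>p\<close> once
      \<open>r\<close> reaches \<open>p * N\<close>.\<close>
    proof (intro exI[of _ "p * N"] allI impI)
      fix r assume "p * N \<le> r"
      then have "p \<le> r div N" using N by (simp add: less_eq_div_iff_mult_less_eq)
      then show "proj_op p (adj (S_op N i) (basis_ell2 r)) = 0"
        by (simp add: adj_S_op_basis[OF i] proj_op_basis blinfun.zero_right)
    qed
    show "adj (S_op N i) (digit_op j (basis_ell2 r)) = digit_op j (adj (S_op N i) (basis_ell2 r))"
      if "N \<le> r" for j r
    proof -
      have "r div N > 0" "r mod N < N" using that N by (auto simp: div_greater_zero_iff)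
      from insert_digits_append(1)[OF N this, of j]
      have "(insert_digit N ^^ j) r = (insert_digit N ^^ j) (r div N) * N + r mod N"
        by (simp add: div_mult_mod_eq)
      then show ?thesis
        using \<open>r mod N < N\<close> by (simp add: adj_S_op_basis[OF i] digit_op_basis blinfun.zero_right)
    qed
  qed (simp_all add: digit_op_in_L S_op_in_L adj_in_L)
qed

text \<open>This is where the sizes \<open>N ^ n\<close> matter: by
  \<open>insert_digits_less_power\<close> the defect is exactly 0. The projections are their own
  adjoints, so one half suffices.\<close>

lemma regular_proj: "regular_seq digit_op (\<lambda>n. proj_op (N ^ n))"
proof -
  have "half_regular digit_op (\<lambda>n. proj_op (N ^ n))"
  proof (rule half_regularI[OF proj_op_in_L norm_proj_le])
    have "(proj_op (N ^ (n + j)) o\<^sub>L digit_op j) - (digit_op j o\<^sub>L proj_op (N ^ n)) = 0" for n j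
      by (rule op_eq_zeroI)
         (simp_all add: minus_in_L comp_in_L proj_op_in_L digit_op_in_L blinfun.diff_left
           digit_op_basis proj_op_basis insert_digits_less_power[OF N] blinfun.zero_right)
    then show "tail_small (\<lambda>(n, j). (proj_op (N ^ (n + j)) o\<^sub>L digit_op j) - (digit_op j o\<^sub>L proj_op (N ^ n)))"
      by (intro tail_small_zeroI[where m = 0]) (simp add: case_prod_unfold op_zero)
    show "tail_small (\<lambda>n. proj_op p o\<^sub>L proj_op (N ^ n))" for p
      by (intro tail_small_zeroI[where m = p] comp_coproj_eq_zeroI)
         (simp_all add: comp_in_L proj_op_in_L proj_op_basis blinfun.zero_right)
    show "Cauchy (\<lambda>n. proj_op (N ^ n) x)" for x
    proof -
      have "strict_mono (\<lambda>n. N ^ n)" using N by (simp add: strict_mono_def power_strict_increasing)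
      from LIMSEQ_subseq_LIMSEQ[OF proj_tendsto this]
      show ?thesis by (intro LIMSEQ_imp_Cauchy) (simp add: proj_op.rep_eq o_def)
    qed
  qed
  then show ?thesis by (simp add: regular_seq_def adj_proj)
qed

text \<open>Minimality is used twice: first for \<open>cuntz N\<close>, giving regular constant
  sequences, then for \<open>S_alg\<close>, whose generators are products of such a sequence with
  the regular sequence of projections on either side.\<close>

lemma S_alg_cuntz_regular:
  assumes "A \<in> S_alg (\<lambda>n. N ^ n) (cuntz N)"
  shows "regular_seq digit_op A"
proof -
  have cuntz: "regular_seq digit_op (\<lambda>_. B)" if "B \<in> cuntz N" for B
    using that cstar_subalgebra_L_regular[of digit_op, OF digit_op_in_L norm_digit_op_le] regular_S_op
    unfolding cuntz_def by auto
  have "finite_sections (\<lambda>n. N ^ n) B \<in> {A \<in> F_alg (\<lambda>n. N ^ n). regular_seq digit_op A}"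
    if "B \<in> cuntz N" for B
    using that cstar_subalgebra_L_cuntz[of N] finite_sections_in_F[of B "\<lambda>n. N ^ n"]
      regular_comp[OF norm_digit_op_le regular_comp[OF norm_digit_op_le regular_proj cuntz[OF that]] regular_proj]
    by (auto simp: finite_sections_def cstar_subalgebra_L_def)
  then show ?thesis
    using assms cstar_subalgebra_F_regular[of digit_op "\<lambda>n. N ^ n", OF digit_op_in_L norm_digit_op_le]
    unfolding S_alg_def by blast
qed

end

theorem corollary6p20:
  fixes N :: nat
  assumes "N \<ge> 2"
  shows "fractal (\<lambda>n. N ^ n) (S_alg (\<lambda>n. N ^ n) (cuntz N))"
proof (rule fractalI)
  show "cstar_subalgebra_F (\<lambda>n. N ^ n) (S_alg (\<lambda>n. N ^ n) (cuntz N))"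
    using cstar_subalgebra_L_cuntz[of N] unfolding cstar_subalgebra_L_def
    by (intro cstar_subalgebra_F_S_alg) blast
qed (rule regular_vanishing_subseq[OF S_alg_cuntz_regular[OF assms] norm_digit_op_apply[OF assms]])

end
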